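(* Let $N\ge2$ be an integer, $1<p\le N$ and $R>0$. Then the inequality $$\left(\frac{p-1}{p}\right)^p\int_{B_R}\frac{|u|^p}{|x|^p\left(\log\frac{R}{|x|}\right)^p}\,dx\le\int_{B_R}\left|\nabla u\cdot\frac{x}{|x|}\right|^p\,dx$$ holds for any $u\in W_0^{1,p}(B_R)$. The constant $\left(\frac{p-1}{p}\right)^p$ is optimal (cannot be replaced by a larger one) and is not attained (equality holds for no $u\in W_0^{1,p}(B_R)\setminus\{0\}$). Furthermore, the improved inequality $$\left(\frac{p-1}{p}\right)^p\int_{B_R}\frac{|u|^p}{|x|^p\left(\log\frac{R}{|x|}\right)^p}\,dx+\phi_{N,p}(u)\le\int_{B_R}\left|\nabla u\cdot\frac{x}{|x|}\right|^p\,dx$$ holds for any $u\in W_0^{1,p}(B_R)$, where $$\phi_{N,p}(u)=(N-p)\left(\frac{p-1}{p}\right)^{p-1}\int_{B_R}\frac{|u|^p}{|x|^p\left(\log\frac{R}{|x|}\right)^{p-1}}\,dx.$$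
   Context: $B_R\subset\mathbb{R}^N$ is the open ball of radius $R$ centered at $0$. $W_0^{1,p}(B_R)$ is the completion of $C_c^\infty(B_R)$ with respect to the norm $\|\nabla(\cdot)\|_{L^p(B_R)}$. When $p=N$ the term $\phi_{N,p}(u)$ is understood to be $0$. *)

theory Defs
  imports "HOL-Analysis.Analysis"
begin

primrec Ck :: "nat \<Rightarrow> ('a::euclidean_space \<Rightarrow> real) \<Rightarrow> bool" where
  "Ck 0 f \<longleftrightarrow> continuous_on UNIV f"
| "Ck (Suc k) f \<longleftrightarrow>
     (\<exists>f'. (\<forall>x. (f has_derivative f' x) (at x)) \<and> (\<forall>b\<in>Basis. Ck k (\<lambda>x. f' x b)))"

definition Cc_infinity :: "'a::euclidean_space set \<Rightarrow> ('a \<Rightarrow> real) set" where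
  "Cc_infinity U =
     {f. (\<forall>k. Ck k f) \<and> compact (closure {x. f x \<noteq> 0}) \<and> closure {x. f x \<noteq> 0} \<subseteq> U}"

definition Lp_tendsto ::
    "real \<Rightarrow> 'a::euclidean_space set \<Rightarrow> (nat \<Rightarrow> 'a \<Rightarrow> 'b::euclidean_space) \<Rightarrow> ('a \<Rightarrow> 'b) \<Rightarrow> bool" where
  "Lp_tendsto p U f h \<longleftrightarrow>
     (\<lambda>n. \<integral>\<^sup>+x. ennreal (norm (f n x - h x) powr p) \<partial>lebesgue_on U) \<longlonglongrightarrow> 0"

(* W0 p U u g: the function u belongs to the completion of Cc_infinity U under the norm
   "L^p norm of the gradient", and g is its gradient, that is, the value at u of the extension
   of the gradient operator to the completion by continuity. For bounded U the Poincare
   inequality makes a sequence that is Cauchy in this norm Cauchy in L^p; its L^p limit u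
   represents the corresponding element of the completion. Both u and g matter only up to null
   sets of U, and g is then determined by u (it is the weak gradient). Membership of u and g in
   L^p is not listed separately: it follows from the convergence, since test functions and
   their gradients are in L^p. *)
definition W0 ::
    "real \<Rightarrow> 'a::euclidean_space set \<Rightarrow> ('a \<Rightarrow> real) \<Rightarrow> ('a \<Rightarrow> 'a) \<Rightarrow> bool" where
  "W0 p U u g \<longleftrightarrow>
     u \<in> borel_measurable (lebesgue_on U) \<and>
     g \<in> borel_measurable (lebesgue_on U) \<and>
     (\<exists>\<phi> d\<phi>. (\<forall>n. \<phi> n \<in> Cc_infinity U) \<and>
             (\<forall>n x. GDERIV (\<phi> n) x :> d\<phi> n x) \<and>
             Lp_tendsto p U \<phi> u \<and>
             Lp_tendsto p U d\<phi> g)"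

(* The integrals below are extended nonnegative ones, so that an inequality between them also
   asserts finiteness of its left-hand side whenever the right-hand side is finite. The
   integrands take the value 0 at the origin, which is a null set. *)
definition hardy_integral ::
    "real \<Rightarrow> real \<Rightarrow> real \<Rightarrow> ('a::euclidean_space \<Rightarrow> real) \<Rightarrow> ennreal" where
  "hardy_integral p q R u =
     (\<integral>\<^sup>+x. ennreal (\<bar>u x\<bar> powr p / (norm x powr p * ln (R / norm x) powr q))
        \<partial>lebesgue_on (ball 0 R))"

definition radial_energy :: "real \<Rightarrow> real \<Rightarrow> ('a::euclidean_space \<Rightarrow> 'a) \<Rightarrow> ennreal" where
  "radial_energy p R g =
     (\<integral>\<^sup>+x. ennreal (\<bar>g x \<bullet> (x /\<^sub>R norm x)\<bar> powr p) \<partial>lebesgue_on (ball 0 R))"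

(* For p = N the factor 0 makes this 0 even if the integral is infinite, since 0 * \<infinity> = 0
   in ennreal. *)
definition remainder :: "real \<Rightarrow> real \<Rightarrow> ('a::euclidean_space \<Rightarrow> real) \<Rightarrow> ennreal" where
  "remainder p R (u :: 'a \<Rightarrow> real) =
     ennreal ((real DIM('a) - p) * ((p - 1) / p) powr (p - 1)) * hardy_integral p (p - 1) R u"

end

theory Submission
  imports Defs
begin

text \<open>
  The dilation \<open>x \<mapsto> t x\<close> gives a divergence theorem for radial vector fields. Applied to
  \<open>|\<phi>|\<^sup>p A(|x|\<^sup>q + e)\<^sup>1\<^sup>-\<^sup>p x\<close> with \<open>q = p/(p - 1)\<close>, and combined with Young's inequality, it bounds a
  weighted norm of \<open>\<phi>\<close> by the radial energy; the exponent \<open>q\<close> makes the weight nonnegative as soon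
  as \<open>z (p A'(z) + p - 1) \<le> N A(z)\<close>. Fatou's lemma allows \<open>e \<rightarrow> 0\<close> and the passage to the completion.

  The choice \<open>A(|x|\<^sup>q) = q |x|\<^sup>q \<mu>(L)\<close> with \<open>L = ln (R/|x|)\<close> yields the improved
  inequality for \<open>\<mu>(L) = L\<close>. For \<open>\<mu>(L) = L (1 + \<epsilon> L/(1 + L))\<close> the loss is of order \<open>\<epsilon>\<^sup>2\<close> but there is a
  gain of order \<open>\<epsilon>\<close>, which must vanish if equality holds; hence the constant is not attained.

  Optimality is tested near the boundary, on smooth cutoffs of \<open>d\<^sup>k\<close> with \<open>d = R\<^sup>2 - |x|\<^sup>2\<close> and
  \<open>k = (p - 1)/p\<close>. Since \<open>L \<le> d/(2|x|\<^sup>2)\<close>, away from the cutoff the energy density is at most about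
  \<open>k\<^sup>p\<close> times the Hardy density; the cutoff contributes a bounded amount, whereas the Hardy integral
  diverges logarithmically as the cutoff approaches the boundary.
\<close>

section \<open>Integration by parts along rays\<close>

text \<open>With \<open>L = ln (R/|x|)\<close> and \<open>c > 0\<close>, the field
  \<open>|\<phi>|^p c^(p-1) |x|^(-p) L^(1-p) x\<close> leaves, after Young's inequality,
  \<open>(p-1)(c^(p-1) - c^p)\<close> in front of the Hardy density. This is largest at
  \<open>c = k = (p-1)/p\<close>, where it equals \<open>k^p\<close>; the factor
  \<open>q = 1/k\<close> in \<open>A\<close> encodes this choice. Differentiating
  \<open>|x|^(-p) x\<close> instead of \<open>L\<close> produces the term with \<open>N - p\<close>.
  Stationarity at \<open>c = k\<close> is also why the factor \<open>1 + \<epsilon> L/(1+L)\<close>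
  costs only order \<open>\<epsilon>^2\<close>, while its growth in \<open>L\<close> adds
  \<open>\<epsilon> L/(1+L)^2\<close> to the derivative of \<open>\<mu>\<close> at first order. For
  a limit \<open>u\<close> of test functions, equality in Young's inequality would have to be read
  off a weak gradient. Perturbing the weight avoids this: each step stays an inequality between
  integrals, which survives the limit. The formal extremal is \<open>L^k\<close>, whose radial
  energy density is exactly \<open>k^p\<close> times its Hardy density. Near the sphere
  \<open>d\<close> is comparable to \<open>L\<close> and, unlike \<open>L\<close>, it is smooth at
  the origin, hence the test functions built on \<open>d^k\<close>.\<close>

lemma integral_lborel_dilation:
  fixes f :: "'a::euclidean_space \<Rightarrow> real"
  assumes "f \<in> borel_measurable borel" "0 < c"
  shows "(\<integral>x. f (c *\<^sub>R x) \<partial>lborel) = (\<integral>x. f x \<partial>lborel) / c ^ DIM('a)"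
proof -
  have "(\<integral>x. f x \<partial>lborel) =
      (\<integral>x. f x \<partial>density (distr lborel borel (\<lambda>x::'a. 0 + c *\<^sub>R x)) (\<lambda>_. \<bar>c\<bar> ^ DIM('a)))"
    using lborel_affine[of c "0::'a"] assms(2) by simp
  also have "\<dots> = c ^ DIM('a) * (\<integral>x. f (c *\<^sub>R x) \<partial>lborel)"
    using assms by (simp add: integral_density integral_distr)
  finally show ?thesis
    using assms(2) by (simp add: field_simps)
qed

lemma integrable_lborel_bounded_support:
  fixes f :: "'a::euclidean_space \<Rightarrow> real"
  assumes "f \<in> borel_measurable borel" "\<And>x. \<bar>f x\<bar> \<le> B" "\<And>x. r \<le> norm x \<Longrightarrow> f x = 0"
  shows "integrable lborel f"
proof (rule Bochner_Integration.integrable_bound)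
  show "integrable lborel (\<lambda>x::'a. B * indicator (ball 0 r) x)"
    by (intro integrable_mult_right integrable_real_indicator) (use emeasure_lborel_ball_finite[of "0::'a" r] in auto)
  show "AE x in lborel. norm (f x) \<le> norm (B * indicator (ball 0 r) x)"
  proof (rule AE_I2)
    fix x
    show "norm (f x) \<le> norm (B * indicator (ball 0 r) x)"
      using assms(2)[of x] assms(3)[of x] by (cases "norm x < r") auto
  qed
qed (use assms(1) in simp)

text \<open>Differentiate \<open>\<integral> \<psi> (t x) dx = t\<^sup>-\<^sup>N \<integral> \<psi>\<close> at \<open>t = 1\<close>.\<close>

lemma integral_radial_divergence:
  fixes \<psi> P :: "'a::euclidean_space \<Rightarrow> real"
  assumes r: "0 < r" "r < r'"
    and supp: "\<And>x. r \<le> norm x \<Longrightarrow> \<psi> x = 0"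
    and der: "\<And>x. norm x < r' \<Longrightarrow> ((\<lambda>t. \<psi> (t *\<^sub>R x)) has_real_derivative P x) (at 1)"
    and cont: "continuous_on (ball 0 r') \<psi>" "continuous_on (ball 0 r') P"
  shows "integrable lborel (\<lambda>x. indicator (ball 0 r) x * (P x + DIM('a) * \<psi> x))"
    and "(\<integral>x. indicator (ball 0 r) x * (P x + DIM('a) * \<psi> x) \<partial>lborel) = 0"
proof -
  define r2 where "r2 = (r + r') / 2"
  have r2: "r < r2" "r2 < r'" using r by (auto simp: r2_def)
  \<comment> \<open>Dilating \<open>ball 0 r\<close> by at most \<open>1 + \<eta>\<close> keeps it
    inside \<open>cball 0 r2\<close>, a compact set on which both \<open>\<psi>\<close> and
    \<open>P\<close> are bounded.\<close>
  define \<eta> where "\<eta> = min 1 ((r2 - r) / r)"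
  have \<eta>: "0 < \<eta>" "(1 + \<eta>) * r \<le> r2"
  proof -
    show "0 < \<eta>" using r r2 by (simp add: \<eta>_def)
    have "\<eta> * r \<le> (r2 - r) / r * r" using r by (intro mult_right_mono) (auto simp: \<eta>_def)
    also have "\<dots> = r2 - r" using r by simp
    finally show "(1 + \<eta>) * r \<le> r2" using r by (simp add: algebra_simps)
  qed
  have sub: "cball 0 r2 \<subseteq> ball (0::'a) r'" using r2 by auto
  have "compact (P ` cball 0 r2)" "compact (\<psi> ` cball 0 r2)"
    by (intro compact_continuous_image continuous_on_subset[OF cont(2) sub]
        continuous_on_subset[OF cont(1) sub] compact_cball)+
  then obtain B C where B: "\<And>x. x \<in> cball 0 r2 \<Longrightarrow> \<bar>P x\<bar> \<le> B"
      and C: "\<And>x. x \<in> cball 0 r2 \<Longrightarrow> \<bar>\<psi> x\<bar> \<le> C"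
    unfolding compact_eq_bounded_closed bounded_real by (metis image_eqI)
  have B0: "0 \<le> B" and C0: "0 \<le> C" using B[of 0] C[of 0] r r2 by auto
  have psim: "\<psi> \<in> borel_measurable borel"
  proof -
    have "(\<lambda>x. indicator (ball 0 r') x *\<^sub>R \<psi> x) \<in> borel_measurable borel"
      by (intro borel_measurable_continuous_on_indicator cont) auto
    moreover have "(\<lambda>x. indicator (ball 0 r') x *\<^sub>R \<psi> x) = \<psi>"
      using supp r by (auto simp: indicator_def fun_eq_iff)
    ultimately show ?thesis by simp
  qed
  have psiint: "integrable lborel \<psi>"
  proof (rule integrable_lborel_bounded_support[OF psim])
    show "\<bar>\<psi> x\<bar> \<le> C" for x
      using C[of x] supp[of x] C0 r2 by (cases "norm x < r") auto
  qed (use supp in auto)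
  \<comment> \<open>The hypothesis speaks of \<open>t = 1\<close> only; rescaling the base point to
    \<open>t x\<close> gives the derivative at every other \<open>t\<close> on the ray.\<close>
  have ray: "((\<lambda>t. \<psi> (t *\<^sub>R x)) has_real_derivative P (t *\<^sub>R x) / t) (at t)"
    if "0 < t" "t * norm x < r'" for x t
  proof -
    have 1: "((\<lambda>s. \<psi> (s *\<^sub>R (t *\<^sub>R x))) has_real_derivative P (t *\<^sub>R x)) (at (t / t))"
      using der[of "t *\<^sub>R x"] that by simp
    have 2: "((\<lambda>s. s / t) has_real_derivative 1 / t) (at t)"
      using that by (auto intro!: derivative_eq_intros)
    show ?thesis
      using DERIV_chain2[OF 1 2] that by simp
  qed
  define h where "h n = \<eta> / real (Suc n)" for n
  have h: "0 < h n" "h n \<le> \<eta>" for n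
    using \<eta> by (auto simp: h_def field_simps mult_le_cancel_left1)
  have hlim: "h \<longlonglongrightarrow> 0"
    unfolding h_def using LIMSEQ_Suc[OF lim_const_over_n[of \<eta>]] by simp
  define D where "D n x = (\<psi> ((1 + h n) *\<^sub>R x) - \<psi> x) / h n" for n x
  have Dzero: "D n x = 0" if "r \<le> norm x" for n x
  proof -
    have "1 * norm x \<le> (1 + h n) * norm x" using h[of n] by (intro mult_right_mono) auto
    then show ?thesis using that supp[of x] supp[of "(1 + h n) *\<^sub>R x"] h[of n]
      by (simp add: D_def)
  qed
  \<comment> \<open>Domination for the difference quotients: by the mean value theorem each is a
    value \<open>P (z x) / z\<close> with \<open>z > 1\<close>, and it vanishes outside the support
    because dilation only moves points outwards.\<close>
  have Dbound: "\<bar>D n x\<bar> \<le> B * indicator (ball 0 r) x" for n x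
  proof (cases "norm x < r")
    case True
    have le: "t * norm x \<le> r2" if "0 < t" "t \<le> 1 + h n" for t
    proof -
      have "t * norm x \<le> (1 + \<eta>) * r" using that h[of n] True by (intro mult_mono) auto
      then show ?thesis using \<eta> by simp
    qed
    have "\<exists>z>1. z < 1 + h n \<and> \<psi> ((1 + h n) *\<^sub>R x) - \<psi> (1 *\<^sub>R x)
        = (1 + h n - 1) * (P (z *\<^sub>R x) / z)"
    proof (rule MVT2)
      fix t assume "1 \<le> t" "t \<le> 1 + h n"
      then show "((\<lambda>t. \<psi> (t *\<^sub>R x)) has_real_derivative P (t *\<^sub>R x) / t) (at t)"
        using le[of t] r2 by (intro ray) auto
    qed (use h in auto)
    then obtain z where z: "1 < z" "z < 1 + h n" "\<psi> ((1 + h n) *\<^sub>R x) - \<psi> x = h n * (P (z *\<^sub>R x) / z)"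
      by auto
    then have "D n x = P (z *\<^sub>R x) / z" using h[of n] by (simp add: D_def)
    moreover have "\<bar>P (z *\<^sub>R x)\<bar> \<le> B" using B[of "z *\<^sub>R x"] le[of z] z by simp
    then have "\<bar>P (z *\<^sub>R x)\<bar> / z \<le> B"
      using z B0 mult_left_mono[of 1 z B] by (simp add: field_simps)
    ultimately show ?thesis using True z by (simp add: abs_divide)
  qed (use Dzero in auto)
  have Dlim: "(\<lambda>n. D n x) \<longlonglongrightarrow> indicator (ball 0 r) x * P x" for x
  proof (cases "norm x < r")
    case True
    have "((\<lambda>h. (\<psi> ((1 + h) *\<^sub>R x) - \<psi> (1 *\<^sub>R x)) / h) \<longlongrightarrow> P x) (at 0)"
      using der[of x] True r unfolding DERIV_def by simp
    moreover have "filterlim h (at 0) sequentially"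
      using hlim h(1) by (simp add: filterlim_at less_imp_neq[symmetric])
    ultimately have "(\<lambda>n. (\<psi> ((1 + h n) *\<^sub>R x) - \<psi> (1 *\<^sub>R x)) / h n) \<longlonglongrightarrow> P x"
      by (rule filterlim_compose)
    then show ?thesis using True by (simp add: D_def)
  qed (use Dzero in auto)
  have Dm: "D n \<in> borel_measurable lborel" for n
    unfolding D_def using psim by measurable
  have Pm: "(\<lambda>x. indicator (ball 0 r) x * P x) \<in> borel_measurable lborel"
    by (rule borel_measurable_LIMSEQ_real[OF Dlim Dm])
  have w: "integrable lborel (\<lambda>x::'a. B * indicator (ball 0 r) x)"
    by (intro integrable_mult_right integrable_real_indicator) (use emeasure_lborel_ball_finite[of "0::'a" r] in auto)
  have lim1: "(\<lambda>n. integral\<^sup>L lborel (D n)) \<longlonglongrightarrow> (\<integral>x. indicator (ball 0 r) x * P x \<partial>lborel)"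
    by (rule integral_dominated_convergence[where s = D, OF Pm Dm w]) (use Dlim Dbound in auto)
  have Pint: "integrable lborel (\<lambda>x. indicator (ball 0 r) x * P x)"
    by (rule integrable_dominated_convergence[where s = D, OF Pm Dm w]) (use Dlim Dbound in auto)
  \<comment> \<open>The same integrals computed by change of variables; their limit is the
    derivative of \<open>t^(-N)\<close> at 1 times the integral of \<open>\<psi>\<close>.\<close>
  have Dint: "integral\<^sup>L lborel (D n) = ((1 / (1 + h n) ^ DIM('a) - 1) / h n) * integral\<^sup>L lborel \<psi>" for n
  proof -
    have "integrable lborel (\<lambda>x. \<psi> ((1 + h n) *\<^sub>R x))"
    proof (rule integrable_lborel_bounded_support)
      show "\<bar>\<psi> ((1 + h n) *\<^sub>R x)\<bar> \<le> C" for x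
        using C[of "(1 + h n) *\<^sub>R x"] supp[of "(1 + h n) *\<^sub>R x"] C0 r2
        by (cases "norm ((1 + h n) *\<^sub>R x) < r") auto
      show "\<psi> ((1 + h n) *\<^sub>R x) = 0" if "r \<le> norm x" for x
      proof -
        have "1 * norm x \<le> (1 + h n) * norm x" using h[of n] by (intro mult_right_mono) auto
        then show ?thesis using that supp[of "(1 + h n) *\<^sub>R x"] h[of n] by simp
      qed
      show "(\<lambda>x. \<psi> ((1 + h n) *\<^sub>R x)) \<in> borel_measurable borel" using psim by measurable
    qed
    then have "integral\<^sup>L lborel (D n) =
        ((\<integral>x. \<psi> ((1 + h n) *\<^sub>R x) \<partial>lborel) - integral\<^sup>L lborel \<psi>) / h n"
      unfolding D_def using psiint by simp
    also have "(\<integral>x. \<psi> ((1 + h n) *\<^sub>R x) \<partial>lborel) = integral\<^sup>L lborel \<psi> / (1 + h n) ^ DIM('a)"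
      using psim h[of n] by (intro integral_lborel_dilation) auto
    finally show ?thesis by (simp add: algebra_simps diff_divide_distrib)
  qed
  have "((\<lambda>t::real. 1 / t ^ DIM('a)) has_real_derivative - real DIM('a)) (at 1)"
    by (auto intro!: derivative_eq_intros)
  then have "((\<lambda>h::real. (1 / (1 + h) ^ DIM('a) - 1) / h) \<longlongrightarrow> - real DIM('a)) (at 0)"
    unfolding DERIV_def by simp
  moreover have "filterlim h (at 0) sequentially"
    using hlim h(1) by (simp add: filterlim_at less_imp_neq[symmetric])
  ultimately have "(\<lambda>n. (1 / (1 + h n) ^ DIM('a) - 1) / h n) \<longlonglongrightarrow> - real DIM('a)"
    by (rule filterlim_compose)
  then have lim2: "(\<lambda>n. integral\<^sup>L lborel (D n)) \<longlonglongrightarrow> - real DIM('a) * integral\<^sup>L lborel \<psi>"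
    unfolding Dint by (intro tendsto_mult tendsto_const)
  have eq: "(\<integral>x. indicator (ball 0 r) x * P x \<partial>lborel) = - real DIM('a) * integral\<^sup>L lborel \<psi>"
    by (rule LIMSEQ_unique[OF lim1 lim2])
  have fe: "(\<lambda>x. indicator (ball 0 r) x * (P x + DIM('a) * \<psi> x)) =
      (\<lambda>x. indicator (ball 0 r) x * P x + DIM('a) * \<psi> x)"
    using supp by (auto simp: indicator_def fun_eq_iff)
  show "integrable lborel (\<lambda>x. indicator (ball 0 r) x * (P x + DIM('a) * \<psi> x))"
    unfolding fe using Pint psiint by simp
  show "(\<integral>x. indicator (ball 0 r) x * (P x + DIM('a) * \<psi> x) \<partial>lborel) = 0"
    unfolding fe using Pint psiint eq by simp
qed

section \<open>Weighted inequalities for test functions\<close>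

text \<open>Test functions may change sign, so differentiability is needed at 0 too: the difference
  quotient there is \<open>|h| powr (p - 1) * sgn h\<close>, which tends to 0 because
  \<open>p > 1\<close>.\<close>

lemma has_real_derivative_abs_powr:
  fixes t p :: real
  assumes "1 < p"
  shows "((\<lambda>t. \<bar>t\<bar> powr p) has_real_derivative p * (\<bar>t\<bar> powr (p - 1) * sgn t)) (at t)"
proof (cases "t = 0")
  case True
  have "((\<lambda>h::real. \<bar>h\<bar> powr (p - 1) * sgn h) \<longlongrightarrow> 0) (at 0)"
  proof (rule Lim_null_comparison)
    show "\<forall>\<^sub>F h::real in at 0. norm (\<bar>h\<bar> powr (p - 1) * sgn h) \<le> \<bar>h\<bar> powr (p - 1)"
      by (intro always_eventually) (auto simp: abs_mult abs_sgn_eq)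
    have "((\<lambda>h::real. \<bar>h\<bar> powr (p - 1)) \<longlongrightarrow> \<bar>0\<bar> powr (p - 1)) (at 0)"
      using assms by (intro tendsto_powr' tendsto_intros) auto
    then show "((\<lambda>h::real. \<bar>h\<bar> powr (p - 1)) \<longlongrightarrow> 0) (at 0)" using assms by simp
  qed
  moreover have "(\<bar>0 + h\<bar> powr p - \<bar>0\<bar> powr p) / h = \<bar>h\<bar> powr (p - 1) * sgn h" for h :: real
    using assms by (cases "h = 0") (auto simp: powr_diff sgn_if field_simps abs_if)
  ultimately show ?thesis
    unfolding DERIV_def using True by simp
next
  case False
  have "((\<lambda>t. \<bar>t\<bar> powr p) has_real_derivative (p * \<bar>t\<bar> powr (p - 1)) * sgn t) (at t)"
  proof (rule DERIV_chain2[where f = "\<lambda>u. u powr p" and g = abs])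
    show "(abs has_real_derivative sgn t) (at t)"
      using GDERIV_norm[OF False]
      by (simp add: gderiv_def has_field_derivative_def mult_commute_abs)
    show "((\<lambda>u. u powr p) has_real_derivative p * \<bar>t\<bar> powr (p - 1)) (at \<bar>t\<bar>)"
      using False by (intro has_real_derivative_powr) auto
  qed
  then show ?thesis by (simp add: mult.assoc)
qed

lemma continuous_on_abs_powr_sgn:
  fixes f :: "'a::topological_space \<Rightarrow> real"
  assumes "0 < a" "continuous_on S f"
  shows "continuous_on S (\<lambda>x. \<bar>f x\<bar> powr a * sgn (f x))"
proof -
  have "continuous_on ({0..} \<union> {..0}) (\<lambda>t::real. \<bar>t\<bar> powr a * sgn t)"
  proof (rule continuous_on_closed_Un)
    have "continuous_on {0..} (\<lambda>t::real. t powr a)"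
      using assms by (intro continuous_on_powr' continuous_intros) auto
    then show "continuous_on {0..} (\<lambda>t::real. \<bar>t\<bar> powr a * sgn t)"
      by (rule continuous_on_eq) (auto simp: sgn_if)
    have "continuous_on {..0} (\<lambda>t::real. - ((- t) powr a))"
      using assms by (intro continuous_on_powr' continuous_intros) auto
    then show "continuous_on {..0} (\<lambda>t::real. \<bar>t\<bar> powr a * sgn t)"
      by (rule continuous_on_eq) (auto simp: sgn_if)
  qed auto
  moreover have "{0..} \<union> {..0} = (UNIV :: real set)" by auto
  ultimately have "continuous_on (f ` S) (\<lambda>t::real. \<bar>t\<bar> powr a * sgn t)"
    using continuous_on_subset by (metis subset_UNIV)
  from continuous_on_compose[OF assms(2) this] show ?thesis by (simp add: o_def)
qed

lemma Young_powr:
  fixes a b p :: real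
  assumes "1 < p" "0 \<le> a" "0 \<le> b"
  shows "p * (a * b) \<le> a powr p + (p - 1) * b powr (p / (p - 1))"
proof -
  have "a * b \<le> a powr p / p + b powr (p / (p - 1)) / (p / (p - 1))"
    using assms by (intro Youngs_inequality) (auto simp: field_simps)
  then have "p * (a * b) \<le> p * (a powr p / p + b powr (p / (p - 1)) / (p / (p - 1)))"
    using assms by (intro mult_left_mono) auto
  also have "\<dots> = a powr p + (p - 1) * b powr (p / (p - 1))"
    using assms by (simp add: field_simps)
  finally show ?thesis .
qed

lemma GDERIV_ray:
  assumes "GDERIV f x :> d"
  shows "((\<lambda>t. f (t *\<^sub>R x)) has_real_derivative d \<bullet> x) (at 1)"
proof -
  have "((\<lambda>t. f (t *\<^sub>R x)) has_derivative (\<lambda>t. (t *\<^sub>R x) \<bullet> d)) (at (1::real))"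
    using assms unfolding gderiv_def
    by (intro has_derivative_compose[where g = f and f = "\<lambda>t. t *\<^sub>R x"])
       (auto intro!: derivative_eq_intros)
  then show ?thesis
    by (simp add: has_field_derivative_def inner_commute mult_commute_abs)
qed

lemma GDERIV_imp_continuous_on:
  assumes "\<And>x. GDERIV f x :> d x"
  shows "continuous_on UNIV f"
  using assms unfolding gderiv_def
  by (intro continuous_at_imp_continuous_on) (blast intro: has_derivative_continuous)

lemma GDERIV_zero_outside:
  assumes "GDERIV f x :> d" "\<And>x. r \<le> norm x \<Longrightarrow> f x = 0" "r < norm x"
  shows "d = 0"
proof -
  have "(f has_derivative (\<lambda>h. 0)) (at x)"
  proof (rule has_derivative_transform_within_open)
    show "((\<lambda>x. 0) has_derivative (\<lambda>h. 0)) (at x)" by simp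
    show "open {y. r < norm y}" by (intro open_Collect_less continuous_intros)
  qed (use assms in auto)
  then have "(\<lambda>h. h \<bullet> d) = (\<lambda>h. 0)"
    using assms(1) unfolding gderiv_def by (rule has_derivative_unique[rotated])
  then show ?thesis by (metis inner_eq_zero_iff)
qed

text \<open>Here \<open>d\<close> stands for the ray derivative of \<open>u\<close>,
  \<open>n\<close> for \<open>|x|\<close> and \<open>a\<close> for the value of \<open>A\<close>, so
  \<open>d / n\<close> is the radial derivative. Young's inequality is applied to
  \<open>|d / n|\<close> and \<open>b = |u|^(p-1) n a^(1-p)\<close>; as
  \<open>(1-p) p/(p-1) = -p\<close>, the conjugate power of \<open>b\<close> is
  \<open>|u|^p n^q a^(-p)\<close>.\<close>

lemma weighted_young_pointwise:
  fixes p u d n a :: real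
  assumes p: "1 < p" and "0 < a" "0 \<le> n" "n = 0 \<Longrightarrow> d = 0"
  shows "- (p * (\<bar>u\<bar> powr (p - 1) * sgn u) * d * a powr (1 - p))
    \<le> \<bar>d / n\<bar> powr p + (p - 1) * (\<bar>u\<bar> powr p * (n powr (p / (p - 1)) * a powr (- p)))"
proof (cases "n = 0")
  case False
  then have n: "0 < n" using assms by simp
  define b where "b = \<bar>u\<bar> powr (p - 1) * n * a powr (1 - p)"
  have b: "b powr (p / (p - 1)) = \<bar>u\<bar> powr p * (n powr (p / (p - 1)) * a powr (- p))"
  proof -
    have "(1 - p) * (p / (p - 1)) = - p" using p by (simp add: field_simps)
    then show ?thesis using p n assms by (simp add: b_def powr_mult powr_powr)
  qed
  have "- (p * (\<bar>u\<bar> powr (p - 1) * sgn u) * d * a powr (1 - p))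
      \<le> \<bar>p * (\<bar>u\<bar> powr (p - 1) * sgn u) * d * a powr (1 - p)\<bar>" by simp
  also have "\<dots> \<le> p * (\<bar>d / n\<bar> * b)"
    using p n by (auto simp: b_def abs_mult abs_sgn_eq)
  also have "\<dots> \<le> \<bar>d / n\<bar> powr p + (p - 1) * b powr (p / (p - 1))"
    using p n by (intro Young_powr) (auto simp: b_def)
  finally show ?thesis using b by simp
qed (use assms in simp)

text \<open>The divergence of \<open>\<psi> x\<close> integrates to 0, Young's inequality absorbs
  its part containing \<open>d\<phi>\<close>, and the rest is the weight \<open>V\<close>.
  \<open>V\<close> has two arguments because the ray derivative of \<open>z = |x|^q + e\<close> is
  \<open>q |x|^q\<close>, without the shift, while \<open>A\<close> and \<open>A'\<close> are
  evaluated at \<open>z\<close>. The shift keeps \<open>z\<close> away from 0, so the field is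
  regular at the origin.\<close>

lemma hardy_test_regularized:
  fixes \<phi> :: "'a::euclidean_space \<Rightarrow> real" and A A' :: "real \<Rightarrow> real" and p R :: real
  defines "q \<equiv> p / (p - 1)"
  defines "V \<equiv> \<lambda>y z. A z powr (- p) * (DIM('a) * A z - y * (p * A' z + p - 1))"
  assumes p: "1 < p"
    and Apos: "\<And>z. 0 < z \<Longrightarrow> z < R powr q \<Longrightarrow> 0 < A z"
    and Ader: "\<And>z. 0 < z \<Longrightarrow> z < R powr q \<Longrightarrow> (A has_real_derivative A' z) (at z)"
    and Acont: "continuous_on {0<..<R powr q} A'"
    and Aineq: "\<And>z. 0 < z \<Longrightarrow> z < R powr q \<Longrightarrow> z * (p * A' z + p - 1) \<le> DIM('a) * A z"
    and \<phi>: "\<And>x. GDERIV \<phi> x :> d\<phi> x" "continuous_on UNIV d\<phi>"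
    and supp: "\<And>x. r \<le> norm x \<Longrightarrow> \<phi> x = 0"
    and r: "0 < r" "r < r'" and e: "0 < e" "r' powr q + e \<le> R powr q"
  shows "(\<integral>\<^sup>+x. ennreal (\<bar>\<phi> x\<bar> powr p * V (norm x powr q) (norm x powr q + e)) \<partial>lborel)
    \<le> (\<integral>\<^sup>+x. ennreal (\<bar>d\<phi> x \<bullet> (x /\<^sub>R norm x)\<bar> powr p) \<partial>lborel)"
proof -
  define z where "z x = norm x powr q + e" for x :: 'a
  define \<psi> where "\<psi> x = \<bar>\<phi> x\<bar> powr p * A (z x) powr (1 - p)" for x
  \<comment> \<open>The derivative of \<open>\<psi>\<close> along the ray; the coefficient of the
    second term is \<open>(1 - p) q = - p\<close>.\<close>
  define P where "P x = p * (\<bar>\<phi> x\<bar> powr (p - 1) * sgn (\<phi> x)) * (d\<phi> x \<bullet> x) * A (z x) powr (1 - p)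
      - p * \<bar>\<phi> x\<bar> powr p * A (z x) powr (- p) * A' (z x) * norm x powr q" for x
  have q: "1 < q" "(1 - p) * q = - p" using p by (auto simp: q_def field_simps)
  have z: "0 < z x" "z x < R powr q" if "norm x < r'" for x
  proof -
    have "norm x powr q < r' powr q" using that q by (intro powr_less_mono2) auto
    then show "z x < R powr q" using e by (simp add: z_def)
    show "0 < z x" using e by (simp add: z_def add_nonneg_pos)
  qed
  have contz: "continuous_on (ball 0 r') z"
    unfolding z_def using q by (intro continuous_intros continuous_on_powr') auto
  have zimg: "z ` ball 0 r' \<subseteq> {0<..<R powr q}" using z by auto
  have "continuous_on {0<..<R powr q} A"
    using Ader by (intro continuous_at_imp_continuous_on) (metis DERIV_isCont greaterThanLessThan_iff)
  then have contA: "continuous_on (ball 0 r') (\<lambda>x. A (z x))"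
    using contz zimg by (rule continuous_on_compose2)
  have contA': "continuous_on (ball 0 r') (\<lambda>x. A' (z x))"
    using Acont contz zimg by (rule continuous_on_compose2)
  have cont\<phi>: "continuous_on S \<phi>" for S
    using GDERIV_imp_continuous_on[OF \<phi>(1)] continuous_on_subset by blast
  have contd: "continuous_on S d\<phi>" for S
    using \<phi>(2) continuous_on_subset by blast
  have Az: "0 < A (z x)" if "norm x < r'" for x
    using Apos z that by auto
  have contabs: "continuous_on (ball 0 r') (\<lambda>x. \<bar>\<phi> x\<bar> powr p)"
    using p by (intro continuous_on_powr' continuous_intros cont\<phi>) auto
  have contAp: "continuous_on (ball 0 r') (\<lambda>x. A (z x) powr c)" for c
  proof (rule continuous_on_powr[OF contA continuous_on_const])
    show "\<forall>x\<in>ball 0 r'. A (z x) \<noteq> 0" using Az by (metis less_irrefl mem_ball_0)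
  qed
  have cont\<psi>: "continuous_on (ball 0 r') \<psi>"
    unfolding \<psi>_def by (intro continuous_intros contabs contAp)
  have contn: "continuous_on (ball 0 r') (\<lambda>x. norm x powr q)"
    using q by (intro continuous_on_powr' continuous_on_norm continuous_on_id continuous_on_const) auto
  have contsgn: "continuous_on (ball 0 r') (\<lambda>x. \<bar>\<phi> x\<bar> powr (p - 1) * sgn (\<phi> x))"
    using p by (intro continuous_on_abs_powr_sgn cont\<phi>) auto
  have contP: "continuous_on (ball 0 r') P"
    unfolding P_def
    by (intro continuous_on_diff continuous_on_mult continuous_on_const continuous_on_inner
        continuous_on_id contabs contAp contA' contd contn contsgn)
  have der: "((\<lambda>t. \<psi> (t *\<^sub>R x)) has_real_derivative P x) (at 1)" if "norm x < r'" for x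
  proof -
    have d1: "((\<lambda>t. \<bar>\<phi> (t *\<^sub>R x)\<bar> powr p) has_real_derivative
        p * (\<bar>\<phi> x\<bar> powr (p - 1) * sgn (\<phi> x)) * (d\<phi> x \<bullet> x)) (at 1)"
      using DERIV_chain2[OF has_real_derivative_abs_powr[OF p, of "\<phi> (1 *\<^sub>R x)"] GDERIV_ray[OF \<phi>(1)]]
      by simp
    have "((\<lambda>t::real. \<bar>t\<bar> powr q * norm x powr q + e) has_real_derivative q * norm x powr q) (at 1)"
      using DERIV_add[OF DERIV_cmult_right[OF has_real_derivative_abs_powr[OF q(1), of 1],
            of "norm x powr q"] DERIV_const[of e]] by simp
    then have d2: "((\<lambda>t. z (t *\<^sub>R x)) has_real_derivative q * norm x powr q) (at 1)"
      by (simp add: z_def powr_mult)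
    have d3: "((\<lambda>t. A (z (t *\<^sub>R x))) has_real_derivative A' (z x) * (q * norm x powr q)) (at 1)"
      using DERIV_chain2[OF _ d2, of A "A' (z x)"] Ader[of "z x"] z[OF that] by simp
    have d4: "((\<lambda>t. A (z (t *\<^sub>R x)) powr (1 - p)) has_real_derivative
        (1 - p) * A (z x) powr (1 - p - 1) * (A' (z x) * (q * norm x powr q))) (at 1)"
      by (rule DERIV_chain2[OF _ d3, of "\<lambda>u. u powr (1 - p)"])
        (use has_real_derivative_powr[OF Az[OF that], of "1 - p"] in simp)
    have "P x = p * (\<bar>\<phi> x\<bar> powr (p - 1) * sgn (\<phi> x)) * (d\<phi> x \<bullet> x) * A (z (1 *\<^sub>R x)) powr (1 - p)
        + ((1 - p) * A (z x) powr (1 - p - 1) * (A' (z x) * (q * norm x powr q))) * \<bar>\<phi> (1 *\<^sub>R x)\<bar> powr p"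
    proof -
      have "(1 - p) * A (z x) powr (1 - p - 1) * (A' (z x) * (q * norm x powr q)) * \<bar>\<phi> x\<bar> powr p
          = ((1 - p) * q) * (\<bar>\<phi> x\<bar> powr p * A (z x) powr (- p) * A' (z x) * norm x powr q)"
        by (simp add: mult_ac)
      then show ?thesis unfolding P_def q(2) by simp
    qed
    then show ?thesis
      unfolding \<psi>_def using DERIV_mult[OF d1 d4] by simp
  qed
  define W where "W x = indicator (ball 0 r) x * (P x + DIM('a) * \<psi> x)" for x
  define G where "G x = indicator (ball 0 r) x * \<bar>d\<phi> x \<bullet> (x /\<^sub>R norm x)\<bar> powr p" for x
  have \<psi>0: "\<psi> x = 0" if "r \<le> norm x" for x
    using supp[OF that] p by (simp add: \<psi>_def)
  have W: "integrable lborel W" "integral\<^sup>L lborel W = 0"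
    unfolding W_def
    using integral_radial_divergence[OF r, of \<psi> P] \<psi>0 der cont\<psi> contP by auto
  have dm: "d\<phi> \<in> borel_measurable borel"
    using \<phi>(2) by (rule borel_measurable_continuous_onI)
  have G: "integrable lborel G"
  proof -
    have "compact (d\<phi> ` cball 0 r)"
      using contd by (intro compact_continuous_image compact_cball)
    then obtain B where B: "\<And>x. x \<in> cball 0 r \<Longrightarrow> norm (d\<phi> x) \<le> B"
      unfolding compact_eq_bounded_closed bounded_iff by (metis image_eqI)
    show ?thesis
    proof (rule integrable_lborel_bounded_support)
      show "G \<in> borel_measurable borel" unfolding G_def
        by (intro borel_measurable_times borel_measurable_indicator powr_real_measurable
            borel_measurable_abs borel_measurable_inner borel_measurable_scaleR dm) auto
      show "\<bar>G x\<bar> \<le> B powr p" for x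
      proof (cases "norm x < r")
        case True
        have "\<bar>d\<phi> x \<bullet> (x /\<^sub>R norm x)\<bar> \<le> norm (d\<phi> x) * norm (x /\<^sub>R norm x)"
          by (rule Cauchy_Schwarz_ineq2)
        also have "\<dots> \<le> norm (d\<phi> x) * 1"
          by (intro mult_left_mono) (cases "x = 0"; simp)+
        finally have "\<bar>d\<phi> x \<bullet> (x /\<^sub>R norm x)\<bar> \<le> B" using B[of x] True by simp
        then show ?thesis using True p by (simp add: G_def powr_mono2)
      qed (simp add: G_def)
      show "G x = 0" if "r \<le> norm x" for x using that by (simp add: G_def)
    qed
  qed
  have pointwise: "\<bar>\<phi> x\<bar> powr p * V (norm x powr q) (z x) \<le> G x + W x" for x
  proof (cases "norm x < r")
    case True
    then have A: "0 < A (z x)" using Az r by simp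
    have A1: "A (z x) powr (1 - p) = A (z x) powr (- p) * A (z x)"
      using A powr_add[of "A (z x)" "- p" 1] by simp
    have "- (p * (\<bar>\<phi> x\<bar> powr (p - 1) * sgn (\<phi> x)) * (d\<phi> x \<bullet> x) * A (z x) powr (1 - p))
        \<le> \<bar>(d\<phi> x \<bullet> x) / norm x\<bar> powr p
          + (p - 1) * (\<bar>\<phi> x\<bar> powr p * (norm x powr q * A (z x) powr (- p)))"
      unfolding q_def using p A by (intro weighted_young_pointwise) auto
    \<comment> \<open>Adding and subtracting Young's conjugate term
      \<open>(p - 1) |x|^q A^(-p)\<close> is what puts \<open>p - 1\<close> next to
      \<open>p A'\<close> in \<open>V\<close>.\<close>
    moreover have "P x + DIM('a) * \<psi> x =
        p * (\<bar>\<phi> x\<bar> powr (p - 1) * sgn (\<phi> x)) * (d\<phi> x \<bullet> x) * A (z x) powr (1 - p)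
        + (\<bar>\<phi> x\<bar> powr p * V (norm x powr q) (z x)
           + (p - 1) * (\<bar>\<phi> x\<bar> powr p * (norm x powr q * A (z x) powr (- p))))"
      unfolding P_def \<psi>_def V_def A1 by (simp add: algebra_simps)
    ultimately show ?thesis
      using True by (simp add: G_def W_def divide_inverse mult.commute)
  next
    case False
    then show ?thesis using supp[of x] p by (simp add: G_def W_def)
  qed
  \<comment> \<open>\<open>Aineq\<close> holds with the factor \<open>z\<close>, but
    \<open>V\<close> carries the smaller \<open>|x|^q\<close>. If \<open>p A' + p - 1\<close> is
    nonnegative, the smaller factor only helps; otherwise the product is nonpositive and positivity
    of \<open>A\<close> suffices.\<close>
  have V0: "0 \<le> \<bar>\<phi> x\<bar> powr p * V (norm x powr q) (z x)" for x
  proof (cases "norm x < r")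
    case True
    then have zx: "0 < z x" "z x < R powr q" "0 < A (z x)" using z Az r by auto
    have "norm x powr q * (p * A' (z x) + p - 1) \<le> DIM('a) * A (z x)"
    proof (cases "0 \<le> p * A' (z x) + p - 1")
      case True
      then have "norm x powr q * (p * A' (z x) + p - 1) \<le> z x * (p * A' (z x) + p - 1)"
        using e by (intro mult_right_mono) (auto simp: z_def)
      then show ?thesis using Aineq[OF zx(1,2)] by simp
    next
      case False
      then have "norm x powr q * (p * A' (z x) + p - 1) \<le> 0"
        by (intro mult_nonneg_nonpos) auto
      then show ?thesis using zx(3) by (smt (verit) mult_nonneg_nonneg of_nat_0_le_iff)
    qed
    then show ?thesis unfolding V_def by (intro mult_nonneg_nonneg) auto
  qed (use supp[of x] p in simp)
  \<comment> \<open>\<open>W\<close> alone need not have a sign. Only the sum \<open>G + W\<close>,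
    which dominates a nonnegative function, is turned into an extended integral, and there
    \<open>W\<close> contributes 0.\<close>
  have GW: "0 \<le> G x + W x" for x
    using V0 pointwise order_trans by blast
  have "(\<integral>\<^sup>+x. ennreal (\<bar>\<phi> x\<bar> powr p * V (norm x powr q) (z x)) \<partial>lborel)
      \<le> (\<integral>\<^sup>+x. ennreal (G x + W x) \<partial>lborel)"
    using pointwise by (intro nn_integral_mono ennreal_leI)
  also have "\<dots> = ennreal (\<integral>x. G x + W x \<partial>lborel)"
    using G W GW by (intro nn_integral_eq_integral) auto
  also have "\<dots> = ennreal (\<integral>x. G x \<partial>lborel)"
    using G W by simp
  also have "\<dots> = (\<integral>\<^sup>+x. ennreal (G x) \<partial>lborel)"
    by (rule nn_integral_eq_integral[OF G, symmetric]) (simp add: G_def)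
  also have "\<dots> \<le> (\<integral>\<^sup>+x. ennreal (\<bar>d\<phi> x \<bullet> (x /\<^sub>R norm x)\<bar> powr p) \<partial>lborel)"
    by (intro nn_integral_mono ennreal_leI) (auto simp: G_def indicator_def)
  finally show ?thesis unfolding z_def .
qed

section \<open>Passage to the completion\<close>

lemma nn_integral_lebesgue_on_eq_lborel:
  fixes f :: "'a::euclidean_space \<Rightarrow> ennreal"
  assumes "S \<in> sets lebesgue" "\<And>x. x \<notin> S \<Longrightarrow> f x = 0"
  shows "(\<integral>\<^sup>+x. f x \<partial>lebesgue_on S) = (\<integral>\<^sup>+x. f x \<partial>lborel)"
proof -
  have "(\<integral>\<^sup>+x. f x \<partial>lebesgue_on S) = (\<integral>\<^sup>+x. f x * indicator S x \<partial>lebesgue)"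
    using assms(1) by (intro nn_integral_restrict_space) auto
  also have "\<dots> = (\<integral>\<^sup>+x. f x \<partial>lebesgue)"
    using assms(2) by (intro nn_integral_cong) (auto simp: indicator_def)
  also have "\<dots> = (\<integral>\<^sup>+x. f x \<partial>lborel)" by (rule nn_integral_completion)
  finally show ?thesis .
qed

lemma Cc_infinity_supportE:
  fixes \<phi> :: "'a::euclidean_space \<Rightarrow> real"
  assumes "\<phi> \<in> Cc_infinity (ball 0 R)" "0 < R"
  obtains r where "0 < r" "r < R" "\<And>x. r \<le> norm x \<Longrightarrow> \<phi> x = 0"
proof -
  define K where "K = closure {x. \<phi> x \<noteq> 0}"
  have K: "compact K" "K \<subseteq> ball 0 R"
    using assms(1) by (auto simp: Cc_infinity_def K_def)
  obtain s where s: "\<And>x. x \<in> K \<Longrightarrow> norm x \<le> s" "0 \<le> s" "s < R"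
  proof (cases "K = {}")
    case True
    then show ?thesis by (intro that[of 0]) (use assms(2) in auto)
  next
    case False
    then obtain y where "y \<in> K" "\<And>x. x \<in> K \<Longrightarrow> norm x \<le> norm y"
      using continuous_attains_sup[OF K(1), of norm] by (auto intro: continuous_intros)
    moreover have "norm y < R" using \<open>y \<in> K\<close> K(2) by auto
    ultimately show ?thesis by (intro that[of "norm y"]) auto
  qed
  have "\<phi> x = 0" if "(s + R) / 2 \<le> norm x" for x
  proof (rule ccontr)
    assume "\<phi> x \<noteq> 0"
    then have "x \<in> K" unfolding K_def using closure_subset[of "{x. \<phi> x \<noteq> 0}"] by auto
    then have "norm x \<le> s" by (rule s(1))
    then show False using that s(3) by simp
  qed
  moreover have "0 < (s + R) / 2" "(s + R) / 2 < R" using s(2,3) assms(2) by simp_all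
  ultimately show ?thesis using that by blast
qed

lemma Cc_infinity_gradient_continuous:
  fixes \<phi> :: "'a::euclidean_space \<Rightarrow> real"
  assumes "\<phi> \<in> Cc_infinity U" "\<And>x. GDERIV \<phi> x :> d\<phi> x"
  shows "continuous_on UNIV d\<phi>"
proof -
  have "Ck (Suc 0) \<phi>" using assms(1) by (simp add: Cc_infinity_def)
  then obtain f' where f': "\<And>x. (\<phi> has_derivative f' x) (at x)"
      "\<And>b. b \<in> Basis \<Longrightarrow> continuous_on UNIV (\<lambda>x. f' x b)"
    by auto
  have "f' x = (\<lambda>h. h \<bullet> d\<phi> x)" for x
    using f'(1)[of x] assms(2)[of x] unfolding gderiv_def by (rule has_derivative_unique)
  then show ?thesis
    using f'(2) by (subst continuous_on_componentwise) (simp add: inner_commute)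
qed

lemma tendsto_zero_powr_cancel:
  fixes f :: "'a \<Rightarrow> real"
  assumes "((\<lambda>x. f x powr p) \<longlongrightarrow> 0) F" "0 < p" "\<And>x. 0 \<le> f x"
  shows "(f \<longlongrightarrow> 0) F"
proof -
  have "((\<lambda>x. (f x powr p) powr (1 / p)) \<longlongrightarrow> 0 powr (1 / p)) F"
    using assms by (intro tendsto_powr' tendsto_const) auto
  then show ?thesis using assms by (simp add: powr_powr)
qed

text \<open>Applies the subsequence theorem for convergence in \<open>L^1\<close> to the functions
  \<open>norm (f n - h) powr p\<close>.\<close>

lemma Lp_tendsto_AE_subseq:
  fixes f :: "nat \<Rightarrow> 'a::euclidean_space \<Rightarrow> 'b::euclidean_space"
  assumes lim: "Lp_tendsto p U f h" and p: "0 < p"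
    and [measurable]: "\<And>n. f n \<in> borel_measurable (lebesgue_on U)" "h \<in> borel_measurable (lebesgue_on U)"
  shows "\<exists>r::nat\<Rightarrow>nat. strict_mono r \<and> (AE x in lebesgue_on U. (\<lambda>n. f (r n) x) \<longlonglongrightarrow> h x)"
proof -
  let ?M = "lebesgue_on U"
  define e where "e n x = norm (f n x - h x) powr p" for n x
  have em: "e n \<in> borel_measurable ?M" for n unfolding e_def by measurable
  have lim': "(\<lambda>n. \<integral>\<^sup>+x. ennreal (e n x) \<partial>?M) \<longlonglongrightarrow> 0"
    using lim by (simp add: Lp_tendsto_def e_def)
  then have "\<forall>\<^sub>F n in sequentially. (\<integral>\<^sup>+x. ennreal (e n x) \<partial>?M) < 1"
    by (rule order_tendstoD) simp
  \<comment> \<open>The first terms may lie at infinite distance from \<open>h\<close>; from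
    \<open>N\<close> on the differences are integrable, so the subsequence is shifted by
    \<open>N\<close>.\<close>
  then obtain N where N: "\<And>n. N \<le> n \<Longrightarrow> (\<integral>\<^sup>+x. ennreal (e n x) \<partial>?M) < 1"
    by (auto simp: eventually_sequentially)
  have eint: "integrable ?M (e (n + N))" for n
  proof (rule integrableI_bounded)
    show "(\<integral>\<^sup>+x. ennreal (norm (e (n + N) x)) \<partial>?M) < \<infinity>"
      using N[of "n + N"] by (simp add: e_def less_trans[OF _ ennreal_one_less_top])
  qed (rule em)
  have "ennreal (\<integral>x. norm (e (n + N) x) \<partial>?M) = (\<integral>\<^sup>+x. ennreal (e (n + N) x) \<partial>?M)" for n
    using nn_integral_eq_integral[OF eint[of n]] by (simp add: e_def[abs_def])
  then have "(\<lambda>n. ennreal (\<integral>x. norm (e (n + N) x) \<partial>?M)) \<longlonglongrightarrow> ennreal 0"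
    using LIMSEQ_ignore_initial_segment[OF lim', of N] by simp
  then have "(\<lambda>n. \<integral>x. norm (e (n + N) x) \<partial>?M) \<longlonglongrightarrow> 0"
    by (subst (asm) tendsto_ennreal_iff) auto
  from tendsto_L1_AE_subseq[OF eint this]
  obtain r where r: "strict_mono r" "AE x in ?M. (\<lambda>n. e (r n + N) x) \<longlonglongrightarrow> 0" by auto
  have "AE x in ?M. (\<lambda>n. f (r n + N) x) \<longlonglongrightarrow> h x"
  proof (rule AE_mp[OF r(2)], rule AE_I2, rule impI)
    fix x assume "(\<lambda>n. e (r n + N) x) \<longlonglongrightarrow> 0"
    then have "(\<lambda>n. norm (f (r n + N) x - h x)) \<longlonglongrightarrow> 0"
      unfolding e_def by (rule tendsto_zero_powr_cancel[OF _ p]) simp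
    then show "(\<lambda>n. f (r n + N) x) \<longlonglongrightarrow> h x"
      by (simp add: tendsto_norm_zero_iff LIM_zero_iff)
  qed
  moreover have "strict_mono (\<lambda>n. r n + N)" using r(1) by (simp add: strict_mono_def)
  ultimately show ?thesis by (intro exI[of _ "\<lambda>n. r n + N"]) simp
qed

text \<open>Convexity of the power at \<open>l (a/l) + (1-l) (b/(1-l))\<close>. The coefficient of
  \<open>a powr p\<close> tends to 1 as \<open>l\<close> tends to 1, so a vanishing perturbation
  \<open>b\<close> costs nothing in the sharp constant.\<close>

lemma powr_add_le:
  fixes a b p l :: real
  assumes "1 < p" "0 < l" "l < 1" "0 \<le> a" "0 \<le> b"
  shows "(a + b) powr p \<le> l powr (1 - p) * a powr p + (1 - l) powr (1 - p) * b powr p"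
proof -
  have ge1: "1 \<le> c powr (1 - p)" if "0 < c" "c < 1" for c :: real
    using powr_mono_both'[of "1 - p" 0 c c] that assms powr_mono2'[of "1 - p" c 1] by simp
  consider "a = 0" | "b = 0" | "0 < a" "0 < b" using assms by linarith
  then show ?thesis
  proof cases
    case 1
    then show ?thesis using mult_right_mono[OF ge1[of "1 - l"], of "b powr p"] assms by simp
  next
    case 2
    then show ?thesis using mult_right_mono[OF ge1[of l], of "a powr p"] assms by simp
  next
    case 3
    have "((1 - (1 - l)) *\<^sub>R (a / l) + (1 - l) *\<^sub>R (b / (1 - l))) powr p
        \<le> (1 - (1 - l)) * (a / l) powr p + (1 - l) * (b / (1 - l)) powr p"
      using assms 3 by (intro convex_onD[OF powr_convex]) auto
    moreover have "l * (a / l) powr p = l powr (1 - p) * a powr p"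
      "(1 - l) * (b / (1 - l)) powr p = (1 - l) powr (1 - p) * b powr p"
      using assms 3 by (simp_all add: powr_divide powr_diff)
    ultimately show ?thesis using assms by simp
  qed
qed

lemma nn_integral_powr_add_le:
  fixes f g :: "'a \<Rightarrow> real"
  assumes p: "1 < p" and l: "0 < l" "l < 1"
    and [measurable]: "f \<in> borel_measurable M" "g \<in> borel_measurable M"
    and le: "\<And>x. 0 \<le> f x" "\<And>x. 0 \<le> g x" "\<And>x. 0 \<le> h x" "\<And>x. h x \<le> f x + g x"
  shows "(\<integral>\<^sup>+x. ennreal (h x powr p) \<partial>M)
    \<le> ennreal (l powr (1 - p)) * (\<integral>\<^sup>+x. ennreal (f x powr p) \<partial>M)
      + ennreal ((1 - l) powr (1 - p)) * (\<integral>\<^sup>+x. ennreal (g x powr p) \<partial>M)"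
proof -
  have "(\<integral>\<^sup>+x. ennreal (h x powr p) \<partial>M)
      \<le> (\<integral>\<^sup>+x. ennreal (l powr (1 - p)) * ennreal (f x powr p)
        + ennreal ((1 - l) powr (1 - p)) * ennreal (g x powr p) \<partial>M)"
  proof (rule nn_integral_mono)
    fix x
    have "h x powr p \<le> (f x + g x) powr p" using le p by (intro powr_mono2) auto
    also have "\<dots> \<le> l powr (1 - p) * f x powr p + (1 - l) powr (1 - p) * g x powr p"
      using le p l by (intro powr_add_le) auto
    finally show "ennreal (h x powr p) \<le> ennreal (l powr (1 - p)) * ennreal (f x powr p)
        + ennreal ((1 - l) powr (1 - p)) * ennreal (g x powr p)"
      by (simp add: ennreal_mult[symmetric] ennreal_plus[symmetric] ennreal_leI del: ennreal_plus)
  qed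
  also have "\<dots> = ennreal (l powr (1 - p)) * (\<integral>\<^sup>+x. ennreal (f x powr p) \<partial>M)
      + ennreal ((1 - l) powr (1 - p)) * (\<integral>\<^sup>+x. ennreal (g x powr p) \<partial>M)"
    by (subst nn_integral_add) (auto simp: nn_integral_cmult)
  finally show ?thesis .
qed

text \<open>Removes the shift \<open>e\<close> by Fatou's lemma. The right-hand side does not depend
  on \<open>e\<close>, and the nonnegativity of the regularized weight is already part of the
  previous estimate.\<close>

lemma hardy_test:
  fixes \<phi> :: "'a::euclidean_space \<Rightarrow> real" and A A' :: "real \<Rightarrow> real" and p R :: real
  defines "q \<equiv> p / (p - 1)"
  defines "v \<equiv> \<lambda>z. A z powr (- p) * (DIM('a) * A z - z * (p * A' z + p - 1))"
  assumes p: "1 < p" and R: "0 < R"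
    and [measurable]: "A \<in> borel_measurable borel" "A' \<in> borel_measurable borel"
    and Apos: "\<And>z. 0 < z \<Longrightarrow> z < R powr q \<Longrightarrow> 0 < A z"
    and Ader: "\<And>z. 0 < z \<Longrightarrow> z < R powr q \<Longrightarrow> (A has_real_derivative A' z) (at z)"
    and Acont: "continuous_on {0<..<R powr q} A'"
    and Aineq: "\<And>z. 0 < z \<Longrightarrow> z < R powr q \<Longrightarrow> z * (p * A' z + p - 1) \<le> DIM('a) * A z"
    and \<phi>: "\<phi> \<in> Cc_infinity (ball 0 R)" "\<And>x. GDERIV \<phi> x :> d\<phi> x"
  shows "(\<integral>\<^sup>+x. ennreal (\<bar>\<phi> x\<bar> powr p * v (norm x powr q)) \<partial>lebesgue_on (ball 0 R))
    \<le> radial_energy p R d\<phi>"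
proof -
  define V where "V y z = A z powr (- p) * (DIM('a) * A z - y * (p * A' z + p - 1))" for y z
  obtain r where r: "0 < r" "r < R" and supp: "\<And>x. r \<le> norm x \<Longrightarrow> \<phi> x = 0"
    using Cc_infinity_supportE[OF \<phi>(1) R] by metis
  define r' where "r' = (r + R) / 2"
  have r': "r < r'" "r' < R" using r by (auto simp: r'_def)
  have q: "0 < q" using p by (simp add: q_def)
  \<comment> \<open>The largest shift, at \<open>n = 0\<close>, uses exactly the gap between
    \<open>r' powr q\<close> and \<open>R powr q\<close>.\<close>
  define e where "e n = (R powr q - r' powr q) / real (Suc n)" for n
  have D: "0 < R powr q - r' powr q" using r r' q by (simp add: powr_less_mono2)
  have e: "0 < e n" "r' powr q + e n \<le> R powr q" for n
  proof -
    show "0 < e n" unfolding e_def using D by (intro divide_pos_pos) auto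
    have "e n \<le> (R powr q - r' powr q) / 1"
      unfolding e_def using D by (intro divide_left_mono) auto
    then show "r' powr q + e n \<le> R powr q" by simp
  qed
  have elim: "e \<longlonglongrightarrow> 0"
    unfolding e_def using LIMSEQ_Suc[OF lim_const_over_n] by blast
  have contd: "continuous_on UNIV d\<phi>"
    using \<phi> by (rule Cc_infinity_gradient_continuous)
  have [measurable]: "\<phi> \<in> borel_measurable borel"
    using GDERIV_imp_continuous_on[OF \<phi>(2)] by (rule borel_measurable_continuous_onI)
  have vlim: "(\<lambda>n. \<bar>\<phi> x\<bar> powr p * V (norm x powr q) (norm x powr q + e n))
      \<longlonglongrightarrow> \<bar>\<phi> x\<bar> powr p * v (norm x powr q)" if "x \<noteq> 0" for x
  proof (cases "norm x < R")
    case True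
    define y where "y = norm x powr q"
    have y: "0 < y" "y < R powr q"
      using that True q by (auto simp: y_def intro!: powr_less_mono2)
    have ylim: "(\<lambda>n. y + e n) \<longlonglongrightarrow> y"
      using tendsto_add[OF tendsto_const elim, of y] by simp
    have "isCont A' y"
      using Acont y by (simp add: continuous_on_eq_continuous_at)
    then have 1: "(\<lambda>n. A' (y + e n)) \<longlonglongrightarrow> A' y"
      using ylim by (rule isCont_tendsto_compose)
    have 2: "(\<lambda>n. A (y + e n)) \<longlonglongrightarrow> A y"
      using DERIV_isCont[OF Ader[OF y]] ylim by (rule isCont_tendsto_compose)
    have "(\<lambda>n. \<bar>\<phi> x\<bar> powr p * V y (y + e n)) \<longlonglongrightarrow> \<bar>\<phi> x\<bar> powr p * V y y"
      unfolding V_def using Apos[OF y] by (intro tendsto_intros 1 2) auto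
    then show ?thesis by (simp add: y_def V_def v_def)
  qed (use supp[of x] p r in simp)
  have "(\<integral>\<^sup>+x. ennreal (\<bar>\<phi> x\<bar> powr p * v (norm x powr q)) \<partial>lborel)
      = (\<integral>\<^sup>+x. liminf (\<lambda>n. ennreal (\<bar>\<phi> x\<bar> powr p * V (norm x powr q) (norm x powr q + e n))) \<partial>lborel)"
  proof (rule nn_integral_cong_AE)
    \<comment> \<open>At the origin the argument of \<open>A\<close> tends to 0, where nothing is
      assumed about \<open>A\<close>; a single point is negligible.\<close>
    show "AE x in lborel. ennreal (\<bar>\<phi> x\<bar> powr p * v (norm x powr q))
        = liminf (\<lambda>n. ennreal (\<bar>\<phi> x\<bar> powr p * V (norm x powr q) (norm x powr q + e n)))"
      by (rule AE_mp[OF AE_lborel_singleton[of 0]], rule AE_I2)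
        (use lim_imp_Liminf[OF _ tendsto_ennrealI[OF vlim]] in auto)
  qed
  also have "\<dots> \<le> liminf (\<lambda>n. \<integral>\<^sup>+x. ennreal (\<bar>\<phi> x\<bar> powr p * V (norm x powr q) (norm x powr q + e n)) \<partial>lborel)"
    by (rule nn_integral_liminf) (simp add: V_def)
  also have "\<dots> \<le> liminf (\<lambda>n. \<integral>\<^sup>+x. ennreal (\<bar>d\<phi> x \<bullet> (x /\<^sub>R norm x)\<bar> powr p) \<partial>lborel)"
    unfolding V_def q_def using p r r' e supp contd Acont Apos Ader Aineq \<phi>(2)
    by (intro Liminf_mono always_eventually allI
        hardy_test_regularized[where r = r and r' = r' and R = R and A' = A']) (auto simp: q_def)
  also have "\<dots> = (\<integral>\<^sup>+x. ennreal (\<bar>d\<phi> x \<bullet> (x /\<^sub>R norm x)\<bar> powr p) \<partial>lborel)" by (simp add: Liminf_const)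
  also have "\<dots> = radial_energy p R d\<phi>"
    unfolding radial_energy_def
    using GDERIV_zero_outside[OF \<phi>(2) supp] r
    by (intro nn_integral_lebesgue_on_eq_lborel[symmetric]) auto
  finally show ?thesis
    using supp r p by (subst nn_integral_lebesgue_on_eq_lborel) auto
qed


section \<open>Measurability and continuity of the radial energy\<close>

lemma borel_measurable_imp_lebesgue_on:
  fixes f :: "'a::euclidean_space \<Rightarrow> 'b::topological_space"
  assumes "f \<in> borel_measurable borel"
  shows "f \<in> borel_measurable (lebesgue_on S)"
  by (rule measurable_restrict_space1[OF measurable_completion]) (use assms in simp)

lemma hardy_integral_measurable:
  fixes u :: "'a::euclidean_space \<Rightarrow> real"
  assumes [measurable]: "u \<in> borel_measurable (lebesgue_on U)" "f \<in> borel_measurable borel"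
  shows "(\<lambda>x. ennreal (\<bar>u x\<bar> powr p * f (norm x))) \<in> borel_measurable (lebesgue_on U)"
proof -
  have "(\<lambda>x::'a. f (norm x)) \<in> borel_measurable borel" by measurable
  from this have [measurable]: "(\<lambda>x::'a. f (norm x)) \<in> borel_measurable (lebesgue_on U)"
    by (rule borel_measurable_imp_lebesgue_on)
  show ?thesis by measurable
qed

lemma radial_component_le:
  fixes y x :: "'a::real_inner"
  shows "\<bar>y \<bullet> (x /\<^sub>R norm x)\<bar> \<le> norm y"
proof -
  have "\<bar>y \<bullet> (x /\<^sub>R norm x)\<bar> \<le> norm y * norm (x /\<^sub>R norm x)"
    by (rule Cauchy_Schwarz_ineq2)
  also have "\<dots> \<le> norm y * 1" by (intro mult_left_mono) (cases "x = 0"; simp)+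
  finally show ?thesis by simp
qed

lemma radial_component_measurable:
  fixes g :: "'a::euclidean_space \<Rightarrow> 'a"
  assumes [measurable]: "g \<in> borel_measurable (lebesgue_on U)"
  shows "(\<lambda>x. g x \<bullet> (x /\<^sub>R norm x)) \<in> borel_measurable (lebesgue_on U)"
proof -
  have "(\<lambda>x::'a. x /\<^sub>R norm x) \<in> borel_measurable borel" by measurable
  then have [measurable]: "(\<lambda>x::'a. x /\<^sub>R norm x) \<in> borel_measurable (lebesgue_on U)"
    by (rule borel_measurable_imp_lebesgue_on)
  show ?thesis by measurable
qed

text \<open>Taking the radial component does not increase the norm, so the radial energy is
  controlled under convergence of the full gradients in \<open>L^p\<close>.\<close>

lemma radial_energy_perturb:
  fixes g h :: "'a::euclidean_space \<Rightarrow> 'a"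
  assumes p: "1 < p" and l: "0 < l" "l < 1"
    and m: "g \<in> borel_measurable (lebesgue_on (ball 0 R))" "h \<in> borel_measurable (lebesgue_on (ball 0 R))"
  shows "radial_energy p R h \<le> ennreal (l powr (1 - p)) * radial_energy p R g
    + ennreal ((1 - l) powr (1 - p)) * (\<integral>\<^sup>+x. ennreal (norm (h x - g x) powr p) \<partial>lebesgue_on (ball 0 R))"
  unfolding radial_energy_def
proof (rule nn_integral_powr_add_le[OF p l])
  fix x
  have "h x \<bullet> (x /\<^sub>R norm x) = g x \<bullet> (x /\<^sub>R norm x) + (h x - g x) \<bullet> (x /\<^sub>R norm x)"
    by (simp add: inner_diff_left algebra_simps)
  then show "\<bar>h x \<bullet> (x /\<^sub>R norm x)\<bar> \<le> \<bar>g x \<bullet> (x /\<^sub>R norm x)\<bar> + norm (h x - g x)"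
    using radial_component_le[of "h x - g x" x] by linarith
next
  show "(\<lambda>x. \<bar>g x \<bullet> (x /\<^sub>R norm x)\<bar>) \<in> borel_measurable (lebesgue_on (ball 0 R))"
    by (intro borel_measurable_abs radial_component_measurable m)
  show "(\<lambda>x. norm (h x - g x)) \<in> borel_measurable (lebesgue_on (ball 0 R))"
    by (rule measurable_compose[OF borel_measurable_diff[OF m(2,1)] borel_measurable_norm])
qed simp_all

lemma gradient_measurable:
  assumes "\<phi> \<in> Cc_infinity U" "\<And>x. GDERIV \<phi> x :> d\<phi> x"
  shows "d\<phi> \<in> borel_measurable (lebesgue_on S)"
proof -
  have "d\<phi> \<in> borel_measurable borel"
    using Cc_infinity_gradient_continuous[OF assms] by (rule borel_measurable_continuous_onI)
  then show ?thesis
    by (rule borel_measurable_imp_lebesgue_on)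
qed

lemma test_function_measurable:
  assumes "\<And>x. GDERIV \<phi> x :> d\<phi> x"
  shows "\<phi> \<in> borel_measurable (lebesgue_on S)"
proof -
  have "\<phi> \<in> borel_measurable borel"
    using GDERIV_imp_continuous_on[OF assms] by (rule borel_measurable_continuous_onI)
  then show ?thesis
    by (rule borel_measurable_imp_lebesgue_on)
qed

lemma radial_energy_test_finite:
  fixes \<phi> :: "'a::euclidean_space \<Rightarrow> real"
  assumes "\<phi> \<in> Cc_infinity (ball 0 R)" "\<And>x. GDERIV \<phi> x :> d\<phi> x" "0 < p"
  shows "radial_energy p R d\<phi> < \<infinity>"
proof -
  have "compact (d\<phi> ` cball 0 R)"
    using Cc_infinity_gradient_continuous[OF assms(1,2)] continuous_on_subset
    by (intro compact_continuous_image compact_cball) blast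
  then obtain B where B: "\<And>x. x \<in> cball 0 R \<Longrightarrow> norm (d\<phi> x) \<le> B"
    unfolding compact_eq_bounded_closed bounded_iff by (metis image_eqI)
  have "radial_energy p R d\<phi> \<le> (\<integral>\<^sup>+x. ennreal (B powr p) \<partial>lebesgue_on (ball (0::'a) R))"
    unfolding radial_energy_def
  proof (intro nn_integral_mono ennreal_leI powr_mono2)
    fix x assume "x \<in> space (lebesgue_on (ball (0::'a) R))"
    then show "\<bar>d\<phi> x \<bullet> (x /\<^sub>R norm x)\<bar> \<le> B"
      using B[of x] radial_component_le[of "d\<phi> x" x] by auto
  qed (use assms in auto)
  also have "\<dots> = ennreal (B powr p) * emeasure lborel (ball (0::'a) R)"
    by (simp add: emeasure_restrict_space)
  also have "\<dots> < \<infinity>"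
    using emeasure_lborel_ball_finite[of "0::'a" R] by (simp add: ennreal_mult_less_top)
  finally show ?thesis .
qed

text \<open>\<open>W0\<close> does not list integrability of \<open>g\<close>; it follows by
  comparison with one test function whose gradient is at distance less than 1 from
  \<open>g\<close>.\<close>

lemma radial_energy_W0_finite:
  fixes u :: "'a::euclidean_space \<Rightarrow> real"
  assumes "W0 p (ball 0 R) u g" "1 < p"
  shows "radial_energy p R g < \<infinity>"
proof -
  obtain \<phi> d\<phi> where gm: "g \<in> borel_measurable (lebesgue_on (ball 0 R))"
    and \<phi>: "\<And>n. \<phi> n \<in> Cc_infinity (ball 0 R)" "\<And>n x. GDERIV (\<phi> n) x :> d\<phi> n x"
    and lim: "Lp_tendsto p (ball 0 R) d\<phi> g"
    using assms(1) unfolding W0_def by metis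
  have "\<forall>\<^sub>F n in sequentially. (\<integral>\<^sup>+x. ennreal (norm (d\<phi> n x - g x) powr p) \<partial>lebesgue_on (ball 0 R)) < 1"
    using lim unfolding Lp_tendsto_def by (rule order_tendstoD) simp
  then obtain n where n: "(\<integral>\<^sup>+x. ennreal (norm (d\<phi> n x - g x) powr p) \<partial>lebesgue_on (ball 0 R)) < 1"
    by (auto simp: eventually_sequentially)
  have "radial_energy p R g \<le> ennreal ((1/2) powr (1 - p)) * radial_energy p R (d\<phi> n)
    + ennreal ((1 - 1/2) powr (1 - p)) * (\<integral>\<^sup>+x. ennreal (norm (g x - d\<phi> n x) powr p) \<partial>lebesgue_on (ball 0 R))"
    using assms(2) gm gradient_measurable[OF \<phi>(1,2)] by (intro radial_energy_perturb) auto
  also have "\<dots> < \<infinity>"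
    using radial_energy_test_finite[OF \<phi>(1,2), of p n] assms(2) less_trans[OF n ennreal_one_less_top]
    by (simp add: ennreal_mult_less_top norm_minus_commute)
  finally show ?thesis .
qed

text \<open>Fatou's lemma handles the left side along a subsequence converging almost everywhere. On
  the right the energies of the test functions have lower limit at most
  \<open>l powr (1 - p)\<close> times the energy of \<open>g\<close>, for every
  \<open>l < 1\<close>, and then \<open>l\<close> tends to 1.\<close>

lemma hardy_W0:
  fixes u :: "'a::euclidean_space \<Rightarrow> real" and A A' :: "real \<Rightarrow> real" and p R :: real
  defines "q \<equiv> p / (p - 1)"
  defines "v \<equiv> \<lambda>z. A z powr (- p) * (DIM('a) * A z - z * (p * A' z + p - 1))"
  assumes p: "1 < p" and R: "0 < R"
    and [measurable]: "A \<in> borel_measurable borel" "A' \<in> borel_measurable borel"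
    and Apos: "\<And>z. 0 < z \<Longrightarrow> z < R powr q \<Longrightarrow> 0 < A z"
    and Ader: "\<And>z. 0 < z \<Longrightarrow> z < R powr q \<Longrightarrow> (A has_real_derivative A' z) (at z)"
    and Acont: "continuous_on {0<..<R powr q} A'"
    and Aineq: "\<And>z. 0 < z \<Longrightarrow> z < R powr q \<Longrightarrow> z * (p * A' z + p - 1) \<le> DIM('a) * A z"
    and W: "W0 p (ball 0 R) u g"
  shows "(\<integral>\<^sup>+x. ennreal (\<bar>u x\<bar> powr p * v (norm x powr q)) \<partial>lebesgue_on (ball 0 R))
    \<le> radial_energy p R g" (is "?H \<le> _")
proof -
  let ?M = "lebesgue_on (ball (0::'a) R)"
  obtain \<phi> d\<phi> where um: "u \<in> borel_measurable ?M" and gm: "g \<in> borel_measurable ?M"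
    and \<phi>: "\<And>n. \<phi> n \<in> Cc_infinity (ball 0 R)" "\<And>n x. GDERIV (\<phi> n) x :> d\<phi> n x"
    and lim: "Lp_tendsto p (ball 0 R) \<phi> u" "Lp_tendsto p (ball 0 R) d\<phi> g"
    using W unfolding W0_def by metis
  have "\<exists>r::nat\<Rightarrow>nat. strict_mono r \<and> (AE x in ?M. (\<lambda>n. \<phi> (r n) x) \<longlonglongrightarrow> u x)"
    using p um test_function_measurable[OF \<phi>(2)] by (intro Lp_tendsto_AE_subseq[OF lim(1)]) auto
  then obtain r where r: "strict_mono r" "AE x in ?M. (\<lambda>n. \<phi> (r n) x) \<longlonglongrightarrow> u x" by auto
  have vm: "(\<lambda>t. v (t powr q)) \<in> borel_measurable borel"
    unfolding v_def by measurable
  have "?H = (\<integral>\<^sup>+x. liminf (\<lambda>n. ennreal (\<bar>\<phi> (r n) x\<bar> powr p * v (norm x powr q))) \<partial>?M)"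
  proof (rule nn_integral_cong_AE, rule AE_mp[OF r(2)], rule AE_I2, rule impI)
    fix x assume "(\<lambda>n. \<phi> (r n) x) \<longlonglongrightarrow> u x"
    then have "(\<lambda>n. \<bar>\<phi> (r n) x\<bar> powr p * v (norm x powr q)) \<longlonglongrightarrow> \<bar>u x\<bar> powr p * v (norm x powr q)"
      using p by (intro tendsto_mult tendsto_powr' tendsto_rabs tendsto_const) auto
    then show "ennreal (\<bar>u x\<bar> powr p * v (norm x powr q))
        = liminf (\<lambda>n. ennreal (\<bar>\<phi> (r n) x\<bar> powr p * v (norm x powr q)))"
      by (intro lim_imp_Liminf[symmetric] tendsto_ennrealI) auto
  qed
  also have "\<dots> \<le> liminf (\<lambda>n. \<integral>\<^sup>+x. ennreal (\<bar>\<phi> (r n) x\<bar> powr p * v (norm x powr q)) \<partial>?M)"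
    by (intro nn_integral_liminf hardy_integral_measurable[OF test_function_measurable[OF \<phi>(2)] vm])
  also have "\<dots> \<le> liminf (\<lambda>n. radial_energy p R (d\<phi> (r n)))"
    unfolding v_def q_def using p R Acont Apos Ader Aineq \<phi>
    by (intro Liminf_mono always_eventually allI hardy_test[where A' = A']) (auto simp: q_def)
  finally have H: "?H \<le> liminf (\<lambda>n. radial_energy p R (d\<phi> (r n)))" .
  \<comment> \<open>With \<open>l\<close> fixed, the coefficient of the distance \<open>D n\<close>
    is a constant, so that term disappears as \<open>n\<close> grows.\<close>
  have H2: "?H \<le> ennreal (l powr (1 - p)) * radial_energy p R g" if l: "0 < l" "l < 1" for l
  proof -
    define D where "D n = (\<integral>\<^sup>+x. ennreal (norm (d\<phi> (r n) x - g x) powr p) \<partial>?M)" for n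
    have "D \<longlonglongrightarrow> 0"
      using LIMSEQ_subseq_LIMSEQ[OF lim(2)[unfolded Lp_tendsto_def] r(1)] by (simp add: D_def[abs_def] o_def)
    then have "(\<lambda>n. ennreal (l powr (1 - p)) * radial_energy p R g + ennreal ((1 - l) powr (1 - p)) * D n)
        \<longlonglongrightarrow> ennreal (l powr (1 - p)) * radial_energy p R g + ennreal ((1 - l) powr (1 - p)) * 0"
      by (intro tendsto_add tendsto_const ennreal_tendsto_cmult) auto
    then have "liminf (\<lambda>n. ennreal (l powr (1 - p)) * radial_energy p R g + ennreal ((1 - l) powr (1 - p)) * D n)
        = ennreal (l powr (1 - p)) * radial_energy p R g"
      using lim_imp_Liminf[OF sequentially_bot] by auto
    moreover have "liminf (\<lambda>n. radial_energy p R (d\<phi> (r n)))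
        \<le> liminf (\<lambda>n. ennreal (l powr (1 - p)) * radial_energy p R g + ennreal ((1 - l) powr (1 - p)) * D n)"
      unfolding D_def using p l gm gradient_measurable[OF \<phi>(1,2)]
      by (intro Liminf_mono always_eventually allI radial_energy_perturb) auto
    ultimately show ?thesis using H by simp
  qed
  obtain E where E: "radial_energy p R g = ennreal E" "0 \<le> E"
    using radial_energy_W0_finite[OF W p] by (cases "radial_energy p R g") auto
  \<comment> \<open>The values \<open>l = (n+1)/(n+2)\<close> lie strictly between 0 and 1 and tend
    to 1; finiteness of the energy makes this a limit of real numbers.\<close>
  have "(\<lambda>n. ennreal ((real (Suc n) / real (Suc (Suc n))) powr (1 - p) * E)) \<longlonglongrightarrow> ennreal (1 powr (1 - p) * E)"
    by (intro tendsto_ennrealI tendsto_intros LIMSEQ_Suc[OF LIMSEQ_n_over_Suc_n]) auto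
  moreover have "?H \<le> ennreal ((real (Suc n) / real (Suc (Suc n))) powr (1 - p) * E)" for n
    using H2[of "real (Suc n) / real (Suc (Suc n))"] E by (simp add: ennreal_mult)
  ultimately have "?H \<le> ennreal (1 powr (1 - p) * E)"
    by (intro LIMSEQ_le_const) auto
  then show ?thesis using E by simp
qed

section \<open>The logarithmic weights\<close>

text \<open>With \<open>\<mu> = L c(L)\<close>, the weight for \<open>A z = q z \<mu>\<close> is
  \<open>k^p |x|^(-p) \<mu>^(-p) ((N-p)/k \<mu> + p (\<mu>' - k))\<close>, and
  \<open>\<mu>' = c + \<epsilon> L/(1+L)^2\<close>. Both the improved inequality and the
  perturbation argument are instances.\<close>

lemma hardy_log_family:
  fixes u :: "'a::euclidean_space \<Rightarrow> real" and p R \<epsilon> :: real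
  defines "k \<equiv> (p - 1) / p"
  defines "L \<equiv> \<lambda>x::'a. ln (R / norm x)"
  defines "c \<equiv> \<lambda>l. 1 + \<epsilon> * l / (1 + l)"
  assumes p: "1 < p" "p \<le> DIM('a)" and R: "0 < R" and \<epsilon>: "0 \<le> \<epsilon>"
    and W: "W0 p (ball 0 R) u g"
  shows "(\<integral>\<^sup>+x. ennreal (\<bar>u x\<bar> powr p * (k powr p * norm x powr (- p) * (L x * c (L x)) powr (- p) *
      ((DIM('a) - p) / k * (L x * c (L x)) + p * (c (L x) + \<epsilon> * L x / (1 + L x)\<^sup>2 - k))))
    \<partial>lebesgue_on (ball 0 R)) \<le> radial_energy p R g"
proof -
  define q where "q = p / (p - 1)"
  \<comment> \<open>Chosen so that \<open>l (norm x powr q) = L x\<close>, because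
    \<open>k q = 1\<close>.\<close>
  define l where "l z = ln R - k * ln z" for z
  define A where "A z = q * z * (l z * c (l z))" for z
  define A' where "A' z = q * (l z * c (l z)) - (c (l z) + \<epsilon> * l z / (1 + l z)\<^sup>2)" for z
  have k: "0 < k" "k < 1" and q: "0 < q" "q * k = 1" "1 / k = q" "(1 - p) * q = - p"
    using p by (auto simp: k_def q_def field_simps)
  have pk: "p * k = p - 1" using p by (simp add: k_def)
  have lpos: "0 < l z" if "0 < z" "z < R powr q" for z
  proof -
    have "ln z < ln (R powr q)" using that R by (subst ln_less_cancel_iff) auto
    then have "k * ln z < k * (q * ln R)" using k R by (simp add: ln_powr)
    also have "k * (q * ln R) = ln R" using q(2) by (metis mult.assoc mult.commute mult_1)
    finally show ?thesis by (simp add: l_def)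
  qed
  have cge: "1 \<le> c t" if "0 < t" for t
    using that \<epsilon> by (simp add: c_def)
  have Ader: "(A has_real_derivative A' z) (at z)" if "0 < z" "z < R powr q" for z
  proof -
    have dl: "(l has_real_derivative (- k / z)) (at z)"
      unfolding l_def using that by (auto intro!: derivative_eq_intros)
    have dm: "((\<lambda>t. t * c t) has_real_derivative (c t + \<epsilon> * t / (1 + t)\<^sup>2)) (at t)" if "0 < t" for t
    proof -
      have "(c has_real_derivative \<epsilon> / (1 + t)\<^sup>2) (at t)"
        unfolding c_def using that
        by (auto intro!: derivative_eq_intros simp: power2_eq_square algebra_simps)
      from DERIV_mult'[OF DERIV_ident this] show ?thesis by (simp add: ac_simps)
    qed
    have dml: "((\<lambda>z. l z * c (l z)) has_real_derivative
        (c (l z) + \<epsilon> * l z / (1 + l z)\<^sup>2) * (- k / z)) (at z)"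
      using DERIV_chain2[OF dm dl] lpos[OF that] by simp
    have "(A has_real_derivative (q * z) * ((c (l z) + \<epsilon> * l z / (1 + l z)\<^sup>2) * (- k / z))
        + q * (l z * c (l z))) (at z)"
      unfolding A_def by (rule DERIV_mult'[OF _ dml]) (auto intro!: derivative_eq_intros)
    \<comment> \<open>The inner derivative \<open>- k / z\<close> of \<open>l\<close> cancels the
      factor \<open>q z\<close>, which is why \<open>A'\<close> contains \<open>\<mu>'\<close> with
      coefficient \<open>-1\<close>.\<close>
    moreover have "(q * z) * (X * (- k / z)) + q * Y = q * Y - X" for X Y
    proof -
      have "(q * z) * (X * (- k / z)) = - ((q * k) * X)" using that by simp
      then show ?thesis unfolding q(2) by simp
    qed
    ultimately show ?thesis unfolding A'_def by simp
  qed
  have m1: "A \<in> borel_measurable borel"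
    unfolding A_def l_def c_def by measurable
  have m2: "A' \<in> borel_measurable borel"
    unfolding A'_def l_def c_def by measurable
  have "(\<integral>\<^sup>+x. ennreal (\<bar>u x\<bar> powr p * (A (norm x powr q) powr (- p) *
      (DIM('a) * A (norm x powr q) - norm x powr q * (p * A' (norm x powr q) + p - 1))))
    \<partial>lebesgue_on (ball 0 R)) \<le> radial_energy p R g"
    unfolding q_def
  proof (rule hardy_W0[OF p(1) R m1 m2 _ _ _ _ W], fold q_def)
    fix z assume z: "0 < z" "z < R powr q"
    have mu: "0 < l z * c (l z)" using lpos[OF z] cge[OF lpos[OF z]] by simp
    show "0 < A z" unfolding A_def using mu q z by simp
    show "(A has_real_derivative A' z) (at z)" by (rule Ader[OF z])
    \<comment> \<open>Since \<open>\<mu>' \<ge> 1\<close>, the term \<open>- p \<mu>'\<close> in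
      \<open>p A'\<close> outweighs \<open>p - 1\<close>, leaving \<open>p q \<mu>\<close>; the
      assumption \<open>p \<le> N\<close> then gives the sign condition.\<close>
    have "1 \<le> c (l z) + \<epsilon> * l z / (1 + l z)\<^sup>2"
      using cge[OF lpos[OF z]] \<epsilon> lpos[OF z] by (intro add_increasing2) auto
    then have "p * 1 \<le> p * (c (l z) + \<epsilon> * l z / (1 + l z)\<^sup>2)" using p by (intro mult_left_mono) auto
    then have "p * A' z + p - 1 \<le> p * (q * (l z * c (l z)))"
      unfolding A'_def by (simp add: algebra_simps)
    also have "\<dots> \<le> DIM('a) * (q * (l z * c (l z)))"
      using p mu q by (intro mult_right_mono) auto
    finally have "z * (p * A' z + p - 1) \<le> z * (DIM('a) * (q * (l z * c (l z))))"
      using z by (intro mult_left_mono) auto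
    then show "z * (p * A' z + p - 1) \<le> DIM('a) * A z"
      by (simp add: A_def mult_ac)
  next
    have cl: "continuous_on {0<..<R powr q} l"
      unfolding l_def by (intro continuous_intros) auto
    show "continuous_on {0<..<R powr q} A'"
      unfolding A'_def c_def using lpos by (intro continuous_intros cl) force+
  qed
  moreover have "A (norm x powr q) powr (- p) *
      (DIM('a) * A (norm x powr q) - norm x powr q * (p * A' (norm x powr q) + p - 1))
    = k powr p * norm x powr (- p) * (L x * c (L x)) powr (- p) *
      ((DIM('a) - p) / k * (L x * c (L x)) + p * (c (L x) + \<epsilon> * L x / (1 + L x)\<^sup>2 - k))"
    if "x \<in> ball 0 R" for x :: 'a
  proof (cases "x = 0")
    case False
    define y where "y = norm x powr q"
    have y: "0 < y" "y < R powr q" using False that q by (auto simp: y_def intro!: powr_less_mono2)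
    have ly: "l y = L x"
    proof -
      have "k * (q * ln (norm x)) = ln (norm x)" using q(2) by (metis mult.assoc mult.commute mult_1)
      then show ?thesis unfolding l_def y_def L_def using False R by (simp add: ln_powr ln_div)
    qed
    define m where "m = L x * c (L x)"
    have m: "0 < m" using lpos[OF y] cge[OF lpos[OF y]] by (simp add: m_def ly)
    have "A y powr (- p) = q powr (- p) * y powr (- p) * m powr (- p)"
      unfolding A_def ly m_def[symmetric] using q y m by (simp add: powr_mult)
    also have "q powr (- p) = k powr p"
    proof -
      have "q = k powr (- 1)" using k(1) q(3) by (simp add: powr_minus_divide)
      then have "q powr (- p) = (k powr (- 1)) powr (- p)" by (rule arg_cong)
      also have "\<dots> = k powr p" unfolding powr_powr by simp
      finally show ?thesis .
    qed
    finally have 1: "A y powr (- p) = k powr p * y powr (- p) * m powr (- p)" .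
    have 2: "DIM('a) * A y - y * (p * A' y + p - 1)
        = y * ((DIM('a) - p) / k * m + p * (c (L x) + \<epsilon> * L x / (1 + L x)\<^sup>2 - k))"
    proof -
      have e1: "(DIM('a) - p) / k * m = (DIM('a) - p) * (q * m)" unfolding q(3)[symmetric] by simp
      have e2: "p * (X - k) = p * X - (p - 1)" for X by (simp add: right_diff_distrib pk)
      have "DIM('a) * (q * y * m) - y * (p * (q * m - X) + p - 1)
          = y * ((DIM('a) - p) * (q * m) + (p * X - (p - 1)))" for X
        by (simp add: algebra_simps)
      then show ?thesis
        unfolding A_def A'_def ly m_def[symmetric] e1 e2 .
    qed
    have "y powr (- p) * y = y powr (1 - p)"
      using y powr_add[of y "- p" 1] by simp
    also have "\<dots> = norm x powr (- p)"
      unfolding y_def powr_powr using q(4) by (simp add: mult.commute)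
    finally have 3: "y powr (- p) * y = norm x powr (- p)" .
    show ?thesis unfolding y_def[symmetric] 1 2 m_def[symmetric] 3[symmetric]
      by (simp add: mult_ac)
  \<comment> \<open>At the origin both weights are 0, because
    \<open>0 powr (- p) = 0\<close>.\<close>
  qed (simp add: A_def)
  ultimately show ?thesis
    by (subst (asm) nn_integral_cong[where v = "\<lambda>x. ennreal (\<bar>u x\<bar> powr p * (k powr p * norm x powr (- p) * (L x * c (L x)) powr (- p) *
      ((DIM('a) - p) / k * (L x * c (L x)) + p * (c (L x) + \<epsilon> * L x / (1 + L x)\<^sup>2 - k))))"]) auto
qed

text \<open>The case \<open>\<epsilon> = 0\<close>: \<open>\<mu>' = 1\<close> and
  \<open>p (1 - k) = 1\<close>, so the bracket contributes exactly 1 to the Hardy density, and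
  \<open>k^p / k = k^(p-1)\<close> gives the coefficient of the remainder.\<close>

lemma hardy_improved:
  fixes u :: "'a::euclidean_space \<Rightarrow> real" and p R :: real
  assumes p: "1 < p" "p \<le> DIM('a)" and R: "0 < R" and W: "W0 p (ball 0 R) u g"
  shows "ennreal (((p - 1) / p) powr p) * hardy_integral p p R u + remainder p R u \<le> radial_energy p R g"
proof -
  let ?M = "lebesgue_on (ball (0::'a) R)"
  define k where "k = (p - 1) / p"
  define L where "L x = ln (R / norm x)" for x :: 'a
  have k: "0 < k" "p * (1 - k) = 1" using p by (auto simp: k_def field_simps)
  have um: "u \<in> borel_measurable ?M" using W by (simp add: W0_def)
  have m: "(\<lambda>x. ennreal (\<bar>u x\<bar> powr p / (norm x powr p * ln (R / norm x) powr s))) \<in> borel_measurable ?M" for s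
    using hardy_integral_measurable[OF um, of "\<lambda>t. 1 / (t powr p * ln (R / t) powr s)" p] by simp
  \<comment> \<open>The zeros keep the exact shape of the perturbed weight at
    \<open>\<epsilon> = 0\<close>.\<close>
  have eq: "ennreal (\<bar>u x\<bar> powr p * (k powr p * norm x powr (- p) * (L x * (1 + 0 * L x / (1 + L x))) powr (- p) *
      ((DIM('a) - p) / k * (L x * (1 + 0 * L x / (1 + L x))) + p * ((1 + 0 * L x / (1 + L x)) + 0 * L x / (1 + L x)\<^sup>2 - k))))
    = ennreal (k powr p) * ennreal (\<bar>u x\<bar> powr p / (norm x powr p * L x powr p))
      + ennreal ((DIM('a) - p) * k powr (p - 1)) * ennreal (\<bar>u x\<bar> powr p / (norm x powr p * L x powr (p - 1)))"
    (is "ennreal ?l = _") if "x \<in> ball 0 R" for x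
  proof (cases "x = 0")
    case False
    then have Lx: "0 < L x" using that R by (simp add: L_def)
    have 1: "L x powr (- p) * L x = 1 / L x powr (p - 1)"
      using Lx powr_add[of "L x" "- p" 1] powr_minus_divide[of "L x" "p - 1"] by simp
    have 2: "k powr p / k = k powr (p - 1)" using k by (simp add: powr_diff)
    have "?l = (\<bar>u x\<bar> powr p * norm x powr (- p)) * (((DIM('a) - p) * (k powr p / k)) * (L x powr (- p) * L x)
        + k powr p * L x powr (- p) * (p * (1 - k)))"
      by (simp add: algebra_simps)
    also have "\<dots> = k powr p * (\<bar>u x\<bar> powr p / (norm x powr p * L x powr p))
        + ((DIM('a) - p) * k powr (p - 1)) * (\<bar>u x\<bar> powr p / (norm x powr p * L x powr (p - 1)))"
      unfolding 1 2 k(2) by (simp add: powr_minus_divide algebra_simps diff_divide_distrib)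
    finally have "ennreal ?l = ennreal (k powr p * (\<bar>u x\<bar> powr p / (norm x powr p * L x powr p))
        + ((DIM('a) - p) * k powr (p - 1)) * (\<bar>u x\<bar> powr p / (norm x powr p * L x powr (p - 1))))"
      by (rule arg_cong)
    also have "\<dots> = ennreal (k powr p) * ennreal (\<bar>u x\<bar> powr p / (norm x powr p * L x powr p))
      + ennreal ((DIM('a) - p) * k powr (p - 1)) * ennreal (\<bar>u x\<bar> powr p / (norm x powr p * L x powr (p - 1)))"
      using p by (simp add: ennreal_plus[symmetric] ennreal_mult[symmetric] del: ennreal_plus)
    finally show ?thesis .
  qed simp
  have "ennreal (k powr p) * hardy_integral p p R u + remainder p R u
      = (\<integral>\<^sup>+x. ennreal (k powr p) * ennreal (\<bar>u x\<bar> powr p / (norm x powr p * L x powr p))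
      + ennreal ((DIM('a) - p) * k powr (p - 1)) * ennreal (\<bar>u x\<bar> powr p / (norm x powr p * L x powr (p - 1))) \<partial>?M)"
    unfolding remainder_def hardy_integral_def k_def[symmetric] L_def using m
    by (simp add: nn_integral_add nn_integral_cmult)
  also have "\<dots> = (\<integral>\<^sup>+x. ennreal (\<bar>u x\<bar> powr p * (k powr p * norm x powr (- p) * (L x * (1 + 0 * L x / (1 + L x))) powr (- p) *
      ((DIM('a) - p) / k * (L x * (1 + 0 * L x / (1 + L x))) + p * ((1 + 0 * L x / (1 + L x)) + 0 * L x / (1 + L x)\<^sup>2 - k)))) \<partial>?M)"
    by (rule nn_integral_cong) (use eq in simp)
  also have "\<dots> \<le> radial_energy p R g"
    unfolding k_def L_def by (rule hardy_log_family[OF p R _ W]) simp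
  finally show ?thesis unfolding k_def .
qed

section \<open>Non-attainment through perturbed weights\<close>

text \<open>Write \<open>c = 1 + s\<close> with \<open>0 < s \<le> \<epsilon>\<close>. Dropping the
  nonnegative part with \<open>N - p\<close> leaves the bracket
  \<open>1 + p s + p \<epsilon> w\<close>, while \<open>\<mu>^(-p)\<close> brings a factor of at
  least \<open>1 - p s\<close>; the terms linear in \<open>s\<close> cancel. The quadratic loss is
  placed on the right, where no subtraction of extended reals is needed.\<close>

lemma hardy_perturbed:
  fixes u :: "'a::euclidean_space \<Rightarrow> real" and p R \<epsilon> :: real
  defines "k \<equiv> (p - 1) / p"
  defines "L \<equiv> \<lambda>x::'a. ln (R / norm x)"
  assumes p: "1 < p" "p \<le> DIM('a)" and R: "0 < R" and \<epsilon>: "0 < \<epsilon>" "\<epsilon> \<le> 1 / (2 * p)"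
    and W: "W0 p (ball 0 R) u g"
  shows "ennreal (k powr p) * (\<integral>\<^sup>+x. ennreal (\<bar>u x\<bar> powr p / (norm x powr p * L x powr p) *
      (1 + p / 2 * \<epsilon> * (L x / (1 + L x)\<^sup>2))) \<partial>lebesgue_on (ball 0 R))
    \<le> radial_energy p R g + ennreal (k powr p * p\<^sup>2 * \<epsilon>\<^sup>2) * hardy_integral p p R u"
proof -
  let ?M = "lebesgue_on (ball (0::'a) R)"
  define c where "c l = 1 + \<epsilon> * l / (1 + l)" for l
  define h where "h x = \<bar>u x\<bar> powr p / (norm x powr p * L x powr p)" for x
  define w where "w x = L x / (1 + L x)\<^sup>2" for x
  define F where "F x = \<bar>u x\<bar> powr p * (k powr p * norm x powr (- p) * (L x * c (L x)) powr (- p) *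
      ((DIM('a) - p) / k * (L x * c (L x)) + p * (c (L x) + \<epsilon> * L x / (1 + L x)\<^sup>2 - k)))" for x
  have k: "0 < k" "p * k = p - 1" using p by (auto simp: k_def field_simps)
  have um: "u \<in> borel_measurable ?M" using W by (simp add: W0_def)
  have hm: "(\<lambda>x. ennreal (h x)) \<in> borel_measurable ?M"
    unfolding h_def L_def
    using hardy_integral_measurable[OF um, of "\<lambda>t. 1 / (t powr p * ln (R / t) powr p)" p] by simp
  have Fm: "(\<lambda>x. ennreal (F x)) \<in> borel_measurable ?M"
    unfolding F_def L_def c_def
    using hardy_integral_measurable[OF um, of "\<lambda>t. k powr p * t powr (- p) * (ln (R / t) * (1 + \<epsilon> * ln (R / t) / (1 + ln (R / t)))) powr (- p) *
      ((DIM('a) - p) / k * (ln (R / t) * (1 + \<epsilon> * ln (R / t) / (1 + ln (R / t))))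
        + p * ((1 + \<epsilon> * ln (R / t) / (1 + ln (R / t))) + \<epsilon> * ln (R / t) / (1 + ln (R / t))\<^sup>2 - k))" p] by simp
  have wm: "(\<lambda>x. ennreal (h x * (1 + p / 2 * \<epsilon> * w x))) \<in> borel_measurable ?M"
    unfolding h_def L_def w_def
    using hardy_integral_measurable[OF um, of "\<lambda>t. (1 + p / 2 * \<epsilon> * (ln (R / t) / (1 + ln (R / t))\<^sup>2)) / (t powr p * ln (R / t) powr p)" p] by simp
  have key: "k powr p * (h x * (1 + p / 2 * \<epsilon> * w x)) \<le> F x + k powr p * p\<^sup>2 * \<epsilon>\<^sup>2 * h x"
    if "x \<in> ball 0 R" for x
  proof (cases "x = 0")
    case False
    then have Lx: "0 < L x" using that R by (simp add: L_def)
    define s where "s = \<epsilon> * (L x / (1 + L x))"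
    have "L x / (1 + L x) < 1" using Lx by simp
    then have s: "0 < s" "s \<le> \<epsilon>" using \<epsilon> Lx mult_left_mono[of "L x / (1 + L x)" 1 \<epsilon>] by (auto simp: s_def)
    have ps: "p * s \<le> 1 / 2"
      using mult_left_mono[OF order_trans[OF s(2) \<epsilon>(2)], of p] p by simp
    have cs: "c (L x) = 1 + s" by (simp add: c_def s_def)
    \<comment> \<open>Bernoulli's inequality for a negative real exponent, from
      \<open>ln (1 + s) \<le> s\<close> and \<open>1 + y \<le> exp y\<close>.\<close>
    have bern: "1 - p * s \<le> (1 + s) powr (- p)"
    proof -
      have "1 - p * s \<le> 1 + (- p) * ln (1 + s)"
        using p s ln_add_one_self_le_self[of s] by (simp add: mult_left_mono)
      also have "\<dots> \<le> exp ((- p) * ln (1 + s))" by (rule exp_ge_add_one_self)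
      also have "\<dots> = (1 + s) powr (- p)" using s by (simp add: powr_def)
      finally show ?thesis .
    qed
    have w0: "0 \<le> w x" using Lx by (simp add: w_def)
    \<comment> \<open>The bound \<open>\<epsilon> \<le> 1/(2p)\<close> makes \<open>1 - p s\<close>
      at least \<open>1/2\<close>; this is the factor \<open>1/2\<close> in front of the
      gain.\<close>
    have "1 - p\<^sup>2 * \<epsilon>\<^sup>2 + p / 2 * \<epsilon> * w x \<le> (1 - p * s) * (1 + p * s + p * \<epsilon> * w x)"
    proof -
      have "(p * s)\<^sup>2 \<le> (p * \<epsilon>)\<^sup>2" using p s by (intro power_mono mult_left_mono) auto
      moreover have "1 / 2 * (p * \<epsilon> * w x) \<le> (1 - p * s) * (p * \<epsilon> * w x)"
        using ps p \<epsilon> w0 by (intro mult_right_mono) auto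
      moreover have "(1 - p * s) * (1 + p * s + p * \<epsilon> * w x) = 1 - (p * s)\<^sup>2 + (1 - p * s) * (p * \<epsilon> * w x)"
        by (simp add: algebra_simps power2_eq_square)
      ultimately show ?thesis by (simp add: power_mult_distrib)
    qed
    also have "\<dots> \<le> (1 + s) powr (- p) * (1 + p * s + p * \<epsilon> * w x)"
      using bern p s \<epsilon> w0 by (intro mult_right_mono) auto
    also have "1 + p * s + p * \<epsilon> * w x = p * (c (L x) + \<epsilon> * L x / (1 + L x)\<^sup>2 - k)"
      using k by (simp add: cs w_def algebra_simps)
    also have "(1 + s) powr (- p) * (p * (c (L x) + \<epsilon> * L x / (1 + L x)\<^sup>2 - k))
        \<le> (1 + s) powr (- p) * ((DIM('a) - p) / k * (L x * c (L x)) + p * (c (L x) + \<epsilon> * L x / (1 + L x)\<^sup>2 - k))"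
      using p k Lx s by (intro mult_left_mono) (auto simp: cs)
    finally have "(k powr p * h x) * (1 - p\<^sup>2 * \<epsilon>\<^sup>2 + p / 2 * \<epsilon> * w x)
        \<le> (k powr p * h x) * ((1 + s) powr (- p) *
          ((DIM('a) - p) / k * (L x * c (L x)) + p * (c (L x) + \<epsilon> * L x / (1 + L x)\<^sup>2 - k)))"
      by (intro mult_left_mono) (auto simp: h_def)
    also have "\<dots> = F x"
      using Lx s by (simp add: F_def h_def cs powr_mult powr_minus_divide mult_ac)
    finally show ?thesis by (simp add: algebra_simps)
  qed (use p in \<open>simp add: h_def F_def\<close>)
  have h0: "0 \<le> h x" for x by (simp add: h_def)
  have F0: "0 \<le> F x" if "x \<in> ball 0 R" for x
  proof (cases "x = 0")
    case False
    then have Lx: "0 < L x" using that R by (simp add: L_def)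
    have "1 \<le> c (L x)" using Lx \<epsilon> by (simp add: c_def)
    moreover have "k \<le> 1" using p by (simp add: k_def)
    moreover have "0 \<le> \<epsilon> * L x / (1 + L x)\<^sup>2" using Lx \<epsilon> by simp
    ultimately have "0 \<le> c (L x) + \<epsilon> * L x / (1 + L x)\<^sup>2 - k" "0 \<le> c (L x)" by linarith+
    then show ?thesis
      unfolding F_def using Lx p k by (intro mult_nonneg_nonneg add_nonneg_nonneg) auto
  qed (simp add: F_def)
  have "ennreal (k powr p) * (\<integral>\<^sup>+x. ennreal (h x * (1 + p / 2 * \<epsilon> * w x)) \<partial>?M)
      = (\<integral>\<^sup>+x. ennreal (k powr p) * ennreal (h x * (1 + p / 2 * \<epsilon> * w x)) \<partial>?M)"
    using wm by (simp add: nn_integral_cmult)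
  also have "\<dots> \<le> (\<integral>\<^sup>+x. ennreal (F x) + ennreal (k powr p * p\<^sup>2 * \<epsilon>\<^sup>2) * ennreal (h x) \<partial>?M)"
  proof (rule nn_integral_mono)
    fix x assume "x \<in> space ?M"
    then have x: "x \<in> ball 0 R" by simp
    have le: "ennreal (k powr p * (h x * (1 + p / 2 * \<epsilon> * w x))) \<le> ennreal (F x + k powr p * p\<^sup>2 * \<epsilon>\<^sup>2 * h x)"
      by (rule ennreal_leI[OF key[OF x]])
    show "ennreal (k powr p) * ennreal (h x * (1 + p / 2 * \<epsilon> * w x))
        \<le> ennreal (F x) + ennreal (k powr p * p\<^sup>2 * \<epsilon>\<^sup>2) * ennreal (h x)"
    proof -
      have "ennreal (k powr p) * ennreal (h x * (1 + p / 2 * \<epsilon> * w x))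
          = ennreal (k powr p * (h x * (1 + p / 2 * \<epsilon> * w x)))"
        by (simp add: ennreal_mult')
      moreover have "ennreal (F x + k powr p * p\<^sup>2 * \<epsilon>\<^sup>2 * h x)
          = ennreal (F x) + ennreal (k powr p * p\<^sup>2 * \<epsilon>\<^sup>2) * ennreal (h x)"
        using F0[OF x] h0[of x] by (subst ennreal_plus) (simp_all add: ennreal_mult')
      ultimately show ?thesis using le by (simp only:)
    qed
  qed
  also have "\<dots> = (\<integral>\<^sup>+x. ennreal (F x) \<partial>?M) + ennreal (k powr p * p\<^sup>2 * \<epsilon>\<^sup>2) * hardy_integral p p R u"
    using Fm hm by (simp add: nn_integral_add nn_integral_cmult hardy_integral_def h_def L_def)
  also have "(\<integral>\<^sup>+x. ennreal (F x) \<partial>?M) \<le> radial_energy p R g"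
    unfolding F_def c_def k_def L_def by (rule hardy_log_family[OF p R _ W]) (use \<epsilon> in simp)
  finally show ?thesis by (simp add: h_def w_def add_right_mono)
qed


text \<open>Under equality the terms \<open>k^p H\<close> on both sides of the perturbed inequality
  cancel, and a gain of order \<open>\<epsilon>\<close> is bounded by a loss of order
  \<open>\<epsilon>^2\<close>. Hence \<open>J = 0\<close>, and its weight \<open>w\<close> is
  positive in the ball off the origin.\<close>

lemma hardy_not_attained:
  fixes u :: "'a::euclidean_space \<Rightarrow> real" and p R :: real
  assumes p: "1 < p" "p \<le> DIM('a)" and R: "0 < R" and W: "W0 p (ball 0 R) u g"
    and eq: "ennreal (((p - 1) / p) powr p) * hardy_integral p p R u = radial_energy p R g"
  shows "AE x in lebesgue_on (ball 0 R). u x = 0"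
proof -
  let ?M = "lebesgue_on (ball (0::'a) R)"
  define k where "k = (p - 1) / p"
  define L where "L x = ln (R / norm x)" for x :: 'a
  define h where "h x = \<bar>u x\<bar> powr p / (norm x powr p * L x powr p)" for x
  define w where "w x = L x / (1 + L x)\<^sup>2" for x
  define H where "H = hardy_integral p p R u"
  define J where "J = (\<integral>\<^sup>+x. ennreal (h x * w x) \<partial>?M)"
  have k: "0 < k" using p by (simp add: k_def)
  have H_eq: "H = (\<integral>\<^sup>+x. ennreal (h x) \<partial>?M)"
    by (simp add: H_def hardy_integral_def h_def L_def)
  have Lpos: "0 < L x" if "x \<in> ball 0 R" "x \<noteq> 0" for x
    using that R by (simp add: L_def)
  have h0: "0 \<le> h x" for x by (simp add: h_def)
  have w01: "0 \<le> w x \<and> w x \<le> 1" if "x \<in> ball 0 R" for x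
  proof (cases "x = 0")
    case False
    then have Lx: "0 < L x" using Lpos that by simp
    have "L x \<le> (1 + L x)\<^sup>2" using Lx by (simp add: power2_eq_square algebra_simps)
    then show ?thesis using Lx by (simp add: w_def)
  qed (simp add: w_def L_def)
  have um: "u \<in> borel_measurable ?M" using W by (simp add: W0_def)
  have hm: "(\<lambda>x. ennreal (h x)) \<in> borel_measurable ?M"
    unfolding h_def L_def
    using hardy_integral_measurable[OF um, of "\<lambda>t. 1 / (t powr p * ln (R / t) powr p)" p] by simp
  have wm: "(\<lambda>x. ennreal (h x * w x)) \<in> borel_measurable ?M"
    unfolding h_def L_def w_def
    using hardy_integral_measurable[OF um, of "\<lambda>t. (ln (R / t) / (1 + ln (R / t))\<^sup>2) / (t powr p * ln (R / t) powr p)" p]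
    by (simp add: mult_ac)
  \<comment> \<open>Finiteness is what permits the cancellation of \<open>H\<close>; it comes from
    the finite energy of \<open>g\<close>.\<close>
  have "ennreal (k powr p) * H < \<infinity>"
    using radial_energy_W0_finite[OF W p(1)] eq by (simp add: k_def H_def)
  then have "H < \<infinity>" using k by (auto simp: ennreal_mult_less_top)
  then obtain H' where H': "H = ennreal H'" "0 \<le> H'" by (cases H) auto
  have "J \<le> H" unfolding J_def H_eq
    using h0 w01 by (intro nn_integral_mono ennreal_leI) (auto simp: mult_left_le)
  then obtain J' where J': "J = ennreal J'" "0 \<le> J'"
    using H' by (cases J) (auto simp: top_unique)
  have small: "J' \<le> 2 * p * \<epsilon> * H'" if \<epsilon>: "0 < \<epsilon>" "\<epsilon> \<le> 1 / (2 * p)" for \<epsilon>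
  proof -
    have "(\<integral>\<^sup>+x. ennreal (h x * (1 + p / 2 * \<epsilon> * w x)) \<partial>?M)
        = (\<integral>\<^sup>+x. ennreal (h x) + ennreal (p / 2 * \<epsilon>) * ennreal (h x * w x) \<partial>?M)"
    proof (rule nn_integral_cong)
      fix x assume "x \<in> space ?M"
      then have "0 \<le> w x" using w01 by auto
      moreover have "h x * (1 + p / 2 * \<epsilon> * w x) = h x + (p / 2 * \<epsilon>) * (h x * w x)"
        by (simp add: algebra_simps)
      ultimately show "ennreal (h x * (1 + p / 2 * \<epsilon> * w x))
          = ennreal (h x) + ennreal (p / 2 * \<epsilon>) * ennreal (h x * w x)"
        using h0[of x] \<epsilon> p
        by (simp add: ennreal_mult[symmetric] ennreal_plus[symmetric] del: ennreal_plus)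
    qed
    also have "\<dots> = H + ennreal (p / 2 * \<epsilon>) * J"
      using hm wm by (simp add: nn_integral_add nn_integral_cmult H_eq J_def)
    also have "\<dots> = ennreal (H' + p / 2 * \<epsilon> * J')"
      using H' J' \<epsilon> p
      by (simp add: ennreal_mult[symmetric] ennreal_plus[symmetric] del: ennreal_plus)
    finally have 1: "(\<integral>\<^sup>+x. ennreal (h x * (1 + p / 2 * \<epsilon> * w x)) \<partial>?M) = ennreal (H' + p / 2 * \<epsilon> * J')" .
    have "ennreal (k powr p) * ennreal (H' + p / 2 * \<epsilon> * J')
        \<le> ennreal (k powr p) * H + ennreal (k powr p * p\<^sup>2 * \<epsilon>\<^sup>2) * H"
      using hardy_perturbed[OF p R \<epsilon> W] eq unfolding 1[symmetric] h_def w_def L_def k_def H_def by simp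
    then have "ennreal (k powr p * (H' + p / 2 * \<epsilon> * J')) \<le> ennreal (k powr p * H' + k powr p * p\<^sup>2 * \<epsilon>\<^sup>2 * H')"
      using H' J' \<epsilon> p
      by (simp add: ennreal_mult[symmetric] ennreal_plus[symmetric] del: ennreal_plus)
    then have "k powr p * (H' + p / 2 * \<epsilon> * J') \<le> k powr p * (H' + p\<^sup>2 * \<epsilon>\<^sup>2 * H')"
      using H' by (subst (asm) ennreal_le_iff) (auto simp: algebra_simps)
    then have "(p * \<epsilon> / 2) * J' \<le> (p * \<epsilon> / 2) * (2 * p * \<epsilon> * H')"
      using k by (simp add: power2_eq_square mult_ac)
    then show ?thesis using p \<epsilon> by (simp only: mult_le_cancel_left_pos divide_pos_pos mult_pos_pos)
  qed
  have "J' = 0"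
  proof (rule ccontr)
    assume "J' \<noteq> 0"
    then have J0: "0 < J'" using J' by simp
    \<comment> \<open>The second bound makes \<open>2 p \<epsilon> H'\<close> at most
      \<open>J' / 2\<close>; adding 1 to \<open>H'\<close> keeps the denominator positive.\<close>
    define \<epsilon> where "\<epsilon> = min (1 / (2 * p)) (J' / (4 * p * (H' + 1)))"
    have \<epsilon>: "0 < \<epsilon>" "\<epsilon> \<le> 1 / (2 * p)" using J0 p H' by (auto simp: \<epsilon>_def)
    have "2 * p * \<epsilon> * H' \<le> 2 * p * (J' / (4 * p * (H' + 1))) * (H' + 1)"
      using p H' J0 by (intro mult_mono) (auto simp: \<epsilon>_def)
    also have "\<dots> = J' / 2"
    proof -
      have "2 * p * (J' / (4 * p * Q)) * Q = J' / 2" if "0 < Q" for Q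
        using p that by (simp add: field_simps)
      from this[of "H' + 1"] show ?thesis using H' by simp
    qed
    finally show False using small[OF \<epsilon>] J0 by simp
  qed
  then have "J = 0" using J' by simp
  then have "AE x in ?M. ennreal (h x * w x) = 0"
    unfolding J_def using wm by (subst (asm) nn_integral_0_iff_AE) auto
  moreover have "AE x in ?M. x \<noteq> 0"
  proof -
    have "AE x in lebesgue. x \<noteq> (0::'a)"
      using AE_completion[OF AE_lborel_singleton[of "0::'a"]] by simp
    then show ?thesis by (subst AE_restrict_space_iff) auto
  qed
  moreover have "AE x in ?M. x \<in> ball 0 R"
    by (rule AE_I2) simp
  ultimately show ?thesis
  proof eventually_elim
    case (elim x)
    then have Lx: "0 < L x" using Lpos by simp
    have "h x * w x = 0"
      using elim(1) h0[of x] w01[of x] elim(3) by (metis ennreal_eq_0_iff mult_nonneg_nonneg order_antisym)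
    then show ?case using elim Lx by (simp add: h_def w_def)
  qed
qed

section \<open>Smooth functions vanishing near the sphere\<close>

lemma Ck_const: "Ck n (\<lambda>x::'a::euclidean_space. c)"
  by (induction n arbitrary: c) (auto intro!: exI[of _ "\<lambda>x h. 0"])

text \<open>The recursion constrains only the derivatives. The product rule also needs smoothness of
  the undifferentiated factors, which this supplies.\<close>

lemma Ck_SucD: "Ck (Suc n) f \<Longrightarrow> Ck n f"
proof (induction n arbitrary: f)
  case 0
  then obtain f' where "\<And>x. (f has_derivative f' x) (at x)" by auto
  then show ?case
    by (auto intro!: continuous_at_imp_continuous_on has_derivative_continuous)
next
  case (Suc n)
  then obtain f' where "\<And>x. (f has_derivative f' x) (at x)" "\<And>b. b \<in> Basis \<Longrightarrow> Ck (Suc n) (\<lambda>x. f' x b)"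
    by (metis Ck.simps(2))
  then show ?case
    unfolding Ck.simps(2)[of n f] using Suc.IH by blast
qed

lemma Ck_add: "Ck n f \<Longrightarrow> Ck n g \<Longrightarrow> Ck n (\<lambda>x. f x + g x)"
proof (induction n arbitrary: f g)
  case (Suc n)
  obtain f' where f: "\<And>x. (f has_derivative f' x) (at x)" "\<And>b. b \<in> Basis \<Longrightarrow> Ck n (\<lambda>x. f' x b)"
    using Suc.prems(1) by auto
  obtain g' where g: "\<And>x. (g has_derivative g' x) (at x)" "\<And>b. b \<in> Basis \<Longrightarrow> Ck n (\<lambda>x. g' x b)"
    using Suc.prems(2) by auto
  show ?case
    unfolding Ck.simps
    by (rule exI[of _ "\<lambda>x h. f' x h + g' x h"]) (auto intro!: has_derivative_add Suc.IH f g)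
qed (auto intro: continuous_on_add)

lemma Ck_mult: "Ck n f \<Longrightarrow> Ck n g \<Longrightarrow> Ck n (\<lambda>x. f x * g x)"
proof (induction n arbitrary: f g)
  case (Suc n)
  obtain f' where f: "\<And>x. (f has_derivative f' x) (at x)" "\<And>b. b \<in> Basis \<Longrightarrow> Ck n (\<lambda>x. f' x b)"
    using Suc.prems(1) by auto
  obtain g' where g: "\<And>x. (g has_derivative g' x) (at x)" "\<And>b. b \<in> Basis \<Longrightarrow> Ck n (\<lambda>x. g' x b)"
    using Suc.prems(2) by auto
  have "Ck n f" "Ck n g" by (rule Ck_SucD[OF Suc.prems(1)], rule Ck_SucD[OF Suc.prems(2)])
  then show ?case
    unfolding Ck.simps
    by (intro exI[of _ "\<lambda>x h. f x * g' x h + f' x h * g x"])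
      (auto intro!: has_derivative_mult Ck_add Suc.IH f g)
qed (auto intro: continuous_on_mult)

lemma Ck_inner: "Ck n (\<lambda>x::'a::euclidean_space. x \<bullet> b)"
proof (cases n)
  case (Suc m)
  show ?thesis
    unfolding Suc Ck.simps
    by (rule exI[of _ "\<lambda>x h. h \<bullet> b"]) (auto intro!: derivative_eq_intros Ck_const)
qed (auto intro: continuous_intros)

text \<open>A family of functions vanishing to infinite order at \<open>\<sigma>\<close>, spanning a space that is
  closed under differentiation.\<close>

definition flat :: "real \<Rightarrow> real \<Rightarrow> nat \<Rightarrow> real \<Rightarrow> real" where
  "flat \<sigma> a m d = (if \<sigma> < d then d powr a * (1 / (d - \<sigma>)) ^ m * exp (- \<sigma> / (d - \<sigma>)) else 0)"

text \<open>One term of the exponential series is at most the whole sum.\<close>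

lemma power_mult_exp_minus_le:
  fixes y :: real
  assumes "0 \<le> y"
  shows "y ^ n * exp (- y) \<le> fact n"
proof -
  have "(\<Sum>i<Suc n. inverse (fact i) * y ^ i) \<le> exp y"
    unfolding exp_def real_scaleR_def using assms
    by (intro sum_le_suminf summable_exp) auto
  moreover have "inverse (fact n) * y ^ n \<le> (\<Sum>i<Suc n. inverse (fact i) * y ^ i)"
    using assms by (simp add: sum_nonneg)
  ultimately have "inverse (fact n) * y ^ n \<le> exp y" by linarith
  then show ?thesis by (simp add: exp_minus field_simps)
qed

text \<open>The power, the pole and the exponential each contribute one term: the first lowers
  \<open>a\<close> by 1, the others raise \<open>m\<close> by 1 and 2. At
  \<open>d = \<sigma>\<close> the exponential beats every pole.\<close>

lemma has_real_derivative_flat: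
  assumes \<sigma>: "0 < \<sigma>"
  shows "(flat \<sigma> a m has_real_derivative
    (a * flat \<sigma> (a - 1) m d - m * flat \<sigma> a (m + 1) d + \<sigma> * flat \<sigma> a (m + 2) d)) (at d)"
proof -
  consider "\<sigma> < d" | "d < \<sigma>" | "d = \<sigma>" by linarith
  then show ?thesis
  proof cases
    case 1
    let ?f = "\<lambda>d. d powr a * (1 / (d - \<sigma>)) ^ m * exp (- \<sigma> / (d - \<sigma>))"
    let ?t = "1 / (d - \<sigma>)"
    have d1: "((\<lambda>d. d powr a) has_real_derivative a * d powr (a - 1)) (at d)"
      using 1 \<sigma> by (intro has_real_derivative_powr) auto
    have d0: "((\<lambda>d. 1 / (d - \<sigma>)) has_real_derivative - (?t * ?t)) (at d)"
      using 1 by (auto intro!: derivative_eq_intros)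
    have d2: "((\<lambda>d. (1 / (d - \<sigma>)) ^ m) has_real_derivative - (m * ?t ^ (m + 1))) (at d)"
      using DERIV_power[OF d0, of m] by (cases m) (simp_all add: mult_ac)
    have d3: "((\<lambda>d. exp (- \<sigma> / (d - \<sigma>))) has_real_derivative exp (- \<sigma> / (d - \<sigma>)) * (\<sigma> * (?t * ?t))) (at d)"
      using DERIV_fun_exp[OF DERIV_cmult[OF d0, of "- \<sigma>"]] by simp
    have "(?f has_real_derivative
        (a * d powr (a - 1) * ?t ^ m + - (m * ?t ^ (m + 1)) * d powr a) * exp (- \<sigma> / (d - \<sigma>))
        + exp (- \<sigma> / (d - \<sigma>)) * (\<sigma> * (?t * ?t)) * (d powr a * ?t ^ m)) (at d)"
      by (intro DERIV_mult d1 d2 d3)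
    then have "(?f has_real_derivative
        (a * flat \<sigma> (a - 1) m d - m * flat \<sigma> a (m + 1) d + \<sigma> * flat \<sigma> a (m + 2) d)) (at d)"
      by (rule DERIV_cong) (use 1 in \<open>simp add: flat_def algebra_simps\<close>)
    then show ?thesis
      by (rule has_field_derivative_transform_within_open[of _ _ _ "{\<sigma><..}"]) (use 1 in \<open>auto simp: flat_def\<close>)
  next
    case 2
    have "((\<lambda>d. 0) has_real_derivative 0) (at d)" by simp
    then have "(flat \<sigma> a m has_real_derivative 0) (at d)"
      by (rule has_field_derivative_transform_within_open[of _ _ _ "{..<\<sigma>}"]) (use 2 in \<open>auto simp: flat_def\<close>)
    then show ?thesis using 2 by (simp add: flat_def)
  next
    case 3
    \<comment> \<open>From \<open>y^(m+2) exp (- y) \<le> (m+2)!\<close> with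
      \<open>y = \<sigma> / h\<close>: beyond the pole of order \<open>m\<close> two powers of
      \<open>h\<close> remain, so the difference quotient is still of order
      \<open>h\<close>.\<close>
    define K where "K = fact (m + 2) / \<sigma> ^ (m + 2)"
    have K: "0 \<le> K" using \<sigma> by (simp add: K_def)
    have "((\<lambda>h. flat \<sigma> a m (\<sigma> + h) / h) \<longlongrightarrow> 0) (at 0)"
    proof (rule Lim_null_comparison)
      show "\<forall>\<^sub>F h in at 0. norm (flat \<sigma> a m (\<sigma> + h) / h) \<le> (\<sigma> + h) powr a * (K * \<bar>h\<bar>)"
      proof (rule always_eventually, rule allI)
        fix h :: real
        show "norm (flat \<sigma> a m (\<sigma> + h) / h) \<le> (\<sigma> + h) powr a * (K * \<bar>h\<bar>)"
        proof (cases "0 < h")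
          case True
          have "(\<sigma> / h) ^ (m + 2) * exp (- (\<sigma> / h)) \<le> fact (m + 2)"
            using True \<sigma> by (intro power_mult_exp_minus_le) auto
          then have "(h ^ 2 / \<sigma> ^ (m + 2)) * ((\<sigma> / h) ^ (m + 2) * exp (- (\<sigma> / h))) \<le> (h ^ 2 / \<sigma> ^ (m + 2)) * fact (m + 2)"
            using \<sigma> by (intro mult_left_mono) auto
          also have "(h ^ 2 / \<sigma> ^ (m + 2)) * ((\<sigma> / h) ^ (m + 2) * exp (- (\<sigma> / h))) = (1 / h) ^ m * exp (- (\<sigma> / h))"
            using True \<sigma> by (simp add: power_divide power_add power2_eq_square)
          finally have "(1 / h) ^ m * exp (- (\<sigma> / h)) \<le> K * h ^ 2" by (simp add: K_def mult_ac)
          then have "(1 / h) ^ m * exp (- (\<sigma> / h)) / h \<le> K * h"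
            using True by (simp add: pos_divide_le_eq power2_eq_square mult_ac)
          then have "(\<sigma> + h) powr a * ((1 / h) ^ m * exp (- (\<sigma> / h)) / h) \<le> (\<sigma> + h) powr a * (K * h)"
            by (intro mult_left_mono) auto
          then show ?thesis using True by (simp add: flat_def mult.assoc)
        next
          case False
          then have "flat \<sigma> a m (\<sigma> + h) = 0" by (simp add: flat_def)
          moreover have "0 \<le> (\<sigma> + h) powr a * (K * \<bar>h\<bar>)"
            using K by (intro mult_nonneg_nonneg) auto
          ultimately show ?thesis by (simp only: div_0 norm_zero)
        qed
      qed
      have "((\<lambda>h. (\<sigma> + h) powr a * (K * \<bar>h\<bar>)) \<longlongrightarrow> (\<sigma> + 0) powr a * (K * \<bar>0\<bar>)) (at 0)"
        using \<sigma> by (intro tendsto_intros) auto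
      then show "((\<lambda>h. (\<sigma> + h) powr a * (K * \<bar>h\<bar>)) \<longlongrightarrow> 0) (at 0)" by simp
    qed
    then have "(flat \<sigma> a m has_real_derivative 0) (at \<sigma>)"
      unfolding DERIV_def by (simp add: flat_def)
    then show ?thesis using 3 by (simp add: flat_def)
  qed
qed

lemma has_derivative_flat_radial:
  fixes x :: "'a::euclidean_space"
  assumes \<sigma>: "0 < \<sigma>"
  shows "((\<lambda>x. flat \<sigma> a m (R\<^sup>2 - x \<bullet> x)) has_derivative
    (\<lambda>h. (a * flat \<sigma> (a - 1) m (R\<^sup>2 - x \<bullet> x) - m * flat \<sigma> a (m + 1) (R\<^sup>2 - x \<bullet> x)
      + \<sigma> * flat \<sigma> a (m + 2) (R\<^sup>2 - x \<bullet> x)) * (- 2 * (h \<bullet> x)))) (at x)"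
proof -
  have "((\<lambda>x. R\<^sup>2 - x \<bullet> x) has_derivative (\<lambda>h. - 2 * (h \<bullet> x))) (at x)"
    by (auto intro!: derivative_eq_intros simp: inner_commute)
  from has_derivative_compose[OF this has_real_derivative_flat[OF \<sigma>, of a m "R\<^sup>2 - x \<bullet> x", unfolded has_field_derivative_def]]
  show ?thesis .
qed

text \<open>Each directional derivative is a combination of members of the family times a linear
  function, so the induction must leave \<open>a\<close> and \<open>m\<close> free.\<close>

lemma Ck_flat_radial:
  assumes \<sigma>: "0 < \<sigma>"
  shows "Ck n (\<lambda>x::'a::euclidean_space. flat \<sigma> a m (R\<^sup>2 - x \<bullet> x))"
proof (induction n arbitrary: a m)
  case 0
  show ?case
    using has_derivative_flat_radial[OF \<sigma>]
    by (auto intro!: continuous_at_imp_continuous_on has_derivative_continuous)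
next
  case (Suc n)
  let ?D = "\<lambda>x h. (a * flat \<sigma> (a - 1) m (R\<^sup>2 - x \<bullet> x) - m * flat \<sigma> a (m + 1) (R\<^sup>2 - x \<bullet> x)
      + \<sigma> * flat \<sigma> a (m + 2) (R\<^sup>2 - x \<bullet> x)) * (- 2 * (h \<bullet> x))"
  have "Ck n (\<lambda>x. ?D x b)" for b :: 'a
  proof -
    have "Ck n (\<lambda>x. (a * flat \<sigma> (a - 1) m (R\<^sup>2 - x \<bullet> x) + - real m * flat \<sigma> a (m + 1) (R\<^sup>2 - x \<bullet> x)
      + \<sigma> * flat \<sigma> a (m + 2) (R\<^sup>2 - x \<bullet> x)) * (- 2 * (x \<bullet> b)))"
      by (intro Ck_add Ck_mult Ck_const Ck_inner Suc.IH)
    then show ?thesis by (simp add: inner_commute)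
  qed
  then show ?case
    unfolding Ck.simps
    by (intro exI[of _ ?D] conjI allI ballI has_derivative_flat_radial[OF \<sigma>])
qed

lemma flat_radial_Cc_infinity:
  assumes \<sigma>: "0 < \<sigma>" "\<sigma> < R\<^sup>2" and R: "0 < R"
  shows "(\<lambda>x::'a::euclidean_space. flat \<sigma> a m (R\<^sup>2 - x \<bullet> x)) \<in> Cc_infinity (ball 0 R)"
proof -
  let ?S = "{x::'a. flat \<sigma> a m (R\<^sup>2 - x \<bullet> x) \<noteq> 0}"
  have lt: "sqrt (R\<^sup>2 - \<sigma>) < R" using \<sigma> R by (intro real_less_lsqrt) auto
  have sub: "?S \<subseteq> cball 0 (sqrt (R\<^sup>2 - \<sigma>))"
  proof
    fix x assume "x \<in> ?S"
    then have "(norm x)\<^sup>2 \<le> R\<^sup>2 - \<sigma>" by (auto simp: flat_def dot_square_norm split: if_splits)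
    then show "x \<in> cball 0 (sqrt (R\<^sup>2 - \<sigma>))" by (simp add: real_le_rsqrt)
  qed
  then have cl: "closure ?S \<subseteq> cball 0 (sqrt (R\<^sup>2 - \<sigma>))" by (intro closure_minimal) auto
  moreover have "compact (closure ?S)"
    unfolding compact_closure by (rule bounded_subset[OF bounded_cball sub])
  moreover from cl have "closure ?S \<subseteq> ball 0 R"
    by (rule order_trans) (use lt in auto)
  ultimately show ?thesis
    unfolding Cc_infinity_def mem_Collect_eq by (intro conjI allI Ck_flat_radial \<sigma>(1)) auto
qed

lemma W0_test_function:
  assumes "\<phi> \<in> Cc_infinity U" "\<And>x. GDERIV \<phi> x :> d\<phi> x" "0 < p"
  shows "W0 p U \<phi> d\<phi>"
  unfolding W0_def
proof (intro conjI exI)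
  show "\<phi> \<in> borel_measurable (lebesgue_on U)" by (rule test_function_measurable[OF assms(2)])
  show "d\<phi> \<in> borel_measurable (lebesgue_on U)" by (rule gradient_measurable[OF assms(1,2)])
  show "\<forall>n::nat. \<phi> \<in> Cc_infinity U" using assms by simp
  show "\<forall>(n::nat) x. GDERIV \<phi> x :> d\<phi> x" using assms by simp
qed (simp_all add: Lp_tendsto_def)

section \<open>Volumes of spherical shells\<close>

lemma emeasure_ball_power:
  fixes c :: "'a::euclidean_space"
  assumes "0 \<le> r"
  shows "emeasure lborel (ball c r) = ennreal (r ^ DIM('a) * measure lborel (ball (0::'a) 1))"
  using emeasure_lborel_ball_finite[of c r] content_ball_conv_unit_ball[OF assms, of c]
  by (subst emeasure_eq_ennreal_measure) auto

text \<open>The linear dependence on \<open>a\<close> matters: with \<open>a\<close> proportional to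
  \<open>\<sigma>\<close> it cancels an energy density of size \<open>1/\<sigma>\<close>. For
  \<open>a \<ge> R^2\<close> the volume of the whole ball is already small enough.\<close>

lemma emeasure_boundary_layer_le:
  fixes R a :: real
  assumes R: "0 < R" and a: "0 \<le> a"
  shows "emeasure lborel {x \<in> ball (0::'a::euclidean_space) R. R\<^sup>2 - x \<bullet> x < a}
    \<le> ennreal (DIM('a) * R ^ DIM('a) / R\<^sup>2 * measure lborel (ball (0::'a) 1) * a)"
proof -
  let ?N = "DIM('a)" and ?w = "measure lborel (ball (0::'a) 1)"
  have w: "0 < ?w" by (rule content_ball_pos) simp
  show ?thesis
  proof (cases "a < R\<^sup>2")
    case True
    define r where "r = sqrt (R\<^sup>2 - a)"
    have r: "0 < r" "r \<le> R" "r\<^sup>2 = R\<^sup>2 - a"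
      using True a R by (auto simp: r_def intro!: real_le_lsqrt)
    have "{x \<in> ball (0::'a) R. R\<^sup>2 - x \<bullet> x < a} \<subseteq> ball 0 R - ball 0 r"
    proof
      fix x :: 'a assume x: "x \<in> {x \<in> ball (0::'a) R. R\<^sup>2 - x \<bullet> x < a}"
      then have "r\<^sup>2 < (norm x)\<^sup>2" using r by (simp add: dot_square_norm)
      then have "r < norm x" by (rule power_less_imp_less_base) simp
      then show "x \<in> ball 0 R - ball 0 r" using x by simp
    qed
    then have "emeasure lborel {x \<in> ball (0::'a) R. R\<^sup>2 - x \<bullet> x < a} \<le> emeasure lborel (ball (0::'a) R - ball 0 r)"
      by (intro emeasure_mono) auto
    also have "\<dots> = emeasure lborel (ball (0::'a) R) - emeasure lborel (ball (0::'a) r)"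
      using r emeasure_lborel_ball_finite[of "0::'a" r] by (intro emeasure_Diff) (auto simp: less_top[symmetric])
    also have "\<dots> = ennreal (R ^ ?N * ?w - r ^ ?N * ?w)"
      using r R w by (simp add: emeasure_ball_power ennreal_minus)
    also have "\<dots> \<le> ennreal (?N * R ^ ?N / R\<^sup>2 * ?w * a)"
    proof (rule ennreal_leI)
      \<comment> \<open>Bernoulli's inequality bounds \<open>(r/R)^(2N)\<close> from below, and
        squaring only decreases \<open>r/R \<le> 1\<close>, so the bound passes to
        \<open>(r/R)^N\<close>.\<close>
      have "1 - ?N * (a / R\<^sup>2) \<le> (1 + - (a / R\<^sup>2)) ^ ?N"
        using Bernoulli_inequality[of "- (a / R\<^sup>2)" ?N] True R by simp
      also have "1 + - (a / R\<^sup>2) = (r / R)\<^sup>2"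
        using r R by (simp add: power_divide field_simps)
      also have "((r / R)\<^sup>2) ^ ?N \<le> (r / R) ^ ?N"
      proof (rule power_mono)
        have "(r / R) * (r / R) \<le> (r / R) * 1" using r R by (intro mult_left_mono) auto
        then show "(r / R)\<^sup>2 \<le> r / R" by (simp add: power2_eq_square)
      qed simp
      finally have "R ^ ?N * (1 - ?N * (a / R\<^sup>2)) \<le> R ^ ?N * (r / R) ^ ?N"
        using R by (intro mult_left_mono) auto
      then have "R ^ ?N - r ^ ?N \<le> ?N * R ^ ?N / R\<^sup>2 * a"
        using R by (simp add: power_divide algebra_simps)
      then have "(R ^ ?N - r ^ ?N) * ?w \<le> (?N * R ^ ?N / R\<^sup>2 * a) * ?w"
        using w by (intro mult_right_mono) auto
      then show "R ^ ?N * ?w - r ^ ?N * ?w \<le> ?N * R ^ ?N / R\<^sup>2 * ?w * a"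
        by (simp add: algebra_simps)
    qed
    finally show ?thesis .
  next
    case False
    have "emeasure lborel {x \<in> ball (0::'a) R. R\<^sup>2 - x \<bullet> x < a} \<le> emeasure lborel (ball (0::'a) R)"
      by (intro emeasure_mono) auto
    also have "\<dots> = ennreal (R ^ ?N * ?w)" using R by (simp add: emeasure_ball_power)
    also have "\<dots> \<le> ennreal (?N * R ^ ?N / R\<^sup>2 * ?w * a)"
    proof (rule ennreal_leI)
      have "1 * 1 \<le> real ?N * (a / R\<^sup>2)"
        using False R DIM_positive[where 'a = 'a] by (intro mult_mono) (auto simp: Suc_le_eq)
      then have "(R ^ ?N * ?w) * 1 \<le> (R ^ ?N * ?w) * (?N * (a / R\<^sup>2))"
        using R w by (intro mult_left_mono) auto
      then show "R ^ ?N * ?w \<le> ?N * R ^ ?N / R\<^sup>2 * ?w * a" by (simp add: mult_ac)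
    qed
    finally show ?thesis .
  qed
qed

text \<open>\<open>r^N - s^N \<ge> r^(N-2) (r^2 - s^2)\<close> for \<open>s \<le> r\<close>, and
  \<open>r^2 - s^2 = a\<close>. Splitting off a square is where \<open>N \<ge> 2\<close> enters; the
  bound on \<open>a\<close> gives \<open>r \<ge> R/2\<close>.\<close>

lemma emeasure_shell_ge:
  fixes R a :: real
  assumes N: "2 \<le> DIM('a::euclidean_space)" and R: "0 < R" and a: "0 < a" "2 * a \<le> 3 * R\<^sup>2 / 4"
  shows "ennreal ((R / 2) ^ (DIM('a) - 2) * measure lborel (ball (0::'a) 1) * a)
    \<le> emeasure lborel {x::'a. a < R\<^sup>2 - x \<bullet> x \<and> R\<^sup>2 - x \<bullet> x \<le> 2 * a}"
proof -
  let ?N = "DIM('a)" and ?w = "measure lborel (ball (0::'a) 1)"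
  have w: "0 < ?w" by (rule content_ball_pos) simp
  define r s where "r = sqrt (R\<^sup>2 - a)" and "s = sqrt (R\<^sup>2 - 2 * a)"
  have r: "r\<^sup>2 = R\<^sup>2 - a" "R / 2 \<le> r" and s: "s\<^sup>2 = R\<^sup>2 - 2 * a" "0 \<le> s" "s \<le> r"
  proof -
    show "R / 2 \<le> r" unfolding r_def using a by (intro real_le_rsqrt) (simp add: power_divide)
  qed (use a R in \<open>auto simp: r_def s_def\<close>)
  have "ball 0 r - ball 0 s \<subseteq> {x::'a. a < R\<^sup>2 - x \<bullet> x \<and> R\<^sup>2 - x \<bullet> x \<le> 2 * a}"
  proof
    fix x :: 'a assume x: "x \<in> ball 0 r - ball 0 s"
    then have "(norm x)\<^sup>2 < r\<^sup>2" "s\<^sup>2 \<le> (norm x)\<^sup>2"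
    proof -
      show "(norm x)\<^sup>2 < r\<^sup>2" using x by (intro power_strict_mono) auto
      show "s\<^sup>2 \<le> (norm x)\<^sup>2" using x s(2) by (intro power_mono) auto
    qed
    then show "x \<in> {x::'a. a < R\<^sup>2 - x \<bullet> x \<and> R\<^sup>2 - x \<bullet> x \<le> 2 * a}"
      using r s by (simp add: dot_square_norm)
  qed
  moreover have "{x::'a. a < R\<^sup>2 - x \<bullet> x \<and> R\<^sup>2 - x \<bullet> x \<le> 2 * a} \<in> sets lborel" by measurable
  ultimately have "emeasure lborel (ball (0::'a) r - ball 0 s) \<le> emeasure lborel {x::'a. a < R\<^sup>2 - x \<bullet> x \<and> R\<^sup>2 - x \<bullet> x \<le> 2 * a}"
    by (rule emeasure_mono)
  moreover have "emeasure lborel (ball (0::'a) r - ball 0 s) = emeasure lborel (ball (0::'a) r) - emeasure lborel (ball (0::'a) s)"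
    using s emeasure_lborel_ball_finite[of "0::'a" s] by (intro emeasure_Diff) (auto simp: less_top[symmetric])
  moreover have "\<dots> = ennreal (r ^ ?N * ?w - s ^ ?N * ?w)"
    using r s R w by (simp add: emeasure_ball_power ennreal_minus)
  moreover have "ennreal ((R / 2) ^ (?N - 2) * ?w * a) \<le> ennreal (r ^ ?N * ?w - s ^ ?N * ?w)"
  proof (rule ennreal_leI)
    have "(R / 2) ^ (?N - 2) * a \<le> r ^ (?N - 2) * a"
      using r R a by (intro mult_right_mono power_mono) auto
    also have "r ^ (?N - 2) * a = r ^ (?N - 2) * r\<^sup>2 - r ^ (?N - 2) * s\<^sup>2"
      unfolding r(1) s(1) by (simp add: algebra_simps)
    also have "r ^ (?N - 2) * r\<^sup>2 = r ^ ?N"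
      using N by (metis le_add_diff_inverse2 power_add)
    also have "r ^ ?N - r ^ (?N - 2) * s\<^sup>2 \<le> r ^ ?N - s ^ (?N - 2) * s\<^sup>2"
      using s(2,3) by (intro diff_left_mono mult_right_mono power_mono) auto
    also have "s ^ (?N - 2) * s\<^sup>2 = s ^ ?N"
      using N by (metis le_add_diff_inverse2 power_add)
    finally have "((R / 2) ^ (?N - 2) * a) * ?w \<le> (r ^ ?N - s ^ ?N) * ?w"
      using w by (intro mult_right_mono) auto
    then show "(R / 2) ^ (?N - 2) * ?w * a \<le> r ^ ?N * ?w - s ^ ?N * ?w"
      by (simp add: algebra_simps)
  qed
  ultimately show ?thesis by simp
qed

text \<open>The logarithmic divergence counted over dyadic shells: each of the \<open>n\<close>
  shells contributes at least the same constant. \<open>D\<close> is the value of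
  \<open>R^2 - |x|^2\<close> at \<open>|x| = R/2\<close>.\<close>

lemma nn_integral_inverse_dist_ge:
  fixes R :: real
  assumes N: "2 \<le> DIM('a::euclidean_space)" and R: "0 < R"
  defines "D \<equiv> 3 * R\<^sup>2 / 4"
  shows "ennreal (n * ((R / 2) ^ (DIM('a) - 2) * measure lborel (ball (0::'a) 1) / 2))
    \<le> (\<integral>\<^sup>+x. ennreal (1 / (R\<^sup>2 - x \<bullet> x)) * indicator {x. D / 2 ^ n < R\<^sup>2 - x \<bullet> x \<and> R\<^sup>2 - x \<bullet> x \<le> D} x \<partial>(lborel :: 'a measure))"
proof (induction n)
  case (Suc n)
  let ?c = "(R / 2) ^ (DIM('a) - 2) * measure lborel (ball (0::'a) 1)"
  define a where "a = D / 2 ^ Suc n"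
  have a2: "2 * a = D / 2 ^ n" by (simp add: a_def)
  have D: "0 < D" using R by (simp add: D_def)
  have a: "0 < a" "2 * a \<le> 3 * R\<^sup>2 / 4" 
  proof -
    show "0 < a" using D by (simp add: a_def)
    have "D / 2 ^ n \<le> D / 1" using D by (intro divide_left_mono) auto
    then show "2 * a \<le> 3 * R\<^sup>2 / 4" unfolding a2 by (simp add: D_def)
  qed
  let ?S = "\<lambda>b c. {x::'a. b < R\<^sup>2 - x \<bullet> x \<and> R\<^sup>2 - x \<bullet> x \<le> c}"
  have Sm: "?S b c \<in> sets lborel" for b c by measurable
  have c0: "0 \<le> ?c" using R by simp
  have "ennreal (?c / 2) = ennreal (1 / (2 * a)) * ennreal (?c * a)"
    using a c0 by (simp add: ennreal_mult[symmetric])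
  \<comment> \<open>On the shell the integrand is at least \<open>1/(2a)\<close> while the volume is
    at least \<open>?c a\<close>, so \<open>a\<close> cancels.\<close>
  also have "\<dots> \<le> ennreal (1 / (2 * a)) * emeasure lborel (?S a (2 * a))"
    by (intro mult_left_mono emeasure_shell_ge N R a) auto
  also have "\<dots> = (\<integral>\<^sup>+x. ennreal (1 / (2 * a)) * indicator (?S a (2 * a)) x \<partial>lborel)"
    using Sm by (simp add: nn_integral_cmult_indicator)
  also have "\<dots> \<le> (\<integral>\<^sup>+x. ennreal (1 / (R\<^sup>2 - x \<bullet> x)) * indicator (?S a (2 * a)) x \<partial>lborel)"
    using a by (intro nn_integral_mono) (auto simp: indicator_def intro!: ennreal_leI divide_left_mono)
  finally have 1: "ennreal (?c / 2) \<le> (\<integral>\<^sup>+x. ennreal (1 / (R\<^sup>2 - x \<bullet> x)) * indicator (?S a (2 * a)) x \<partial>lborel)" .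
  have "ennreal (Suc n * (?c / 2)) = ennreal (?c / 2) + ennreal (n * (?c / 2))"
    using c0 by (simp add: ennreal_plus[symmetric] algebra_simps add_divide_distrib del: ennreal_plus)
  also have "\<dots> \<le> (\<integral>\<^sup>+x. ennreal (1 / (R\<^sup>2 - x \<bullet> x)) * indicator (?S a (2 * a)) x \<partial>lborel)
      + (\<integral>\<^sup>+x. ennreal (1 / (R\<^sup>2 - x \<bullet> x)) * indicator (?S (2 * a) D) x \<partial>lborel)"
    using Suc.IH unfolding a2 by (intro add_mono 1[unfolded a2]) auto
  also have "\<dots> = (\<integral>\<^sup>+x. ennreal (1 / (R\<^sup>2 - x \<bullet> x)) * indicator (?S a (2 * a)) x
      + ennreal (1 / (R\<^sup>2 - x \<bullet> x)) * indicator (?S (2 * a) D) x \<partial>lborel)"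
    by (intro nn_integral_add[symmetric]) measurable
  also have "\<dots> \<le> (\<integral>\<^sup>+x. ennreal (1 / (R\<^sup>2 - x \<bullet> x)) * indicator (?S a D) x \<partial>lborel)"
    using a by (intro nn_integral_mono) (auto simp: indicator_def D_def)
  finally show ?case unfolding a_def .
qed simp

section \<open>Estimates for the cut-off powers of \<open>d\<close>\<close>

lemma GDERIV_flat_radial:
  fixes x :: "'a::euclidean_space"
  assumes "0 < \<sigma>"
  shows "GDERIV (\<lambda>x. flat \<sigma> k 0 (R\<^sup>2 - x \<bullet> x)) x :>
    (- 2 * (k * flat \<sigma> (k - 1) 0 (R\<^sup>2 - x \<bullet> x) + \<sigma> * flat \<sigma> k 2 (R\<^sup>2 - x \<bullet> x))) *\<^sub>R x"
  unfolding gderiv_def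
  by (rule has_derivative_eq_rhs[OF has_derivative_flat_radial[OF assms]])
    (simp add: fun_eq_iff algebra_simps numeral_2_eq_2)

lemma flat_derivative_eq:
  fixes \<sigma> k d :: real
  assumes "0 < \<sigma>" "\<sigma> < d"
  shows "k * flat \<sigma> (k - 1) 0 d + \<sigma> * flat \<sigma> k 2 d
    = d powr (k - 1) * exp (- (\<sigma> / (d - \<sigma>))) * (k + \<sigma> * d / (d - \<sigma>)\<^sup>2)"
proof -
  have "d powr k = d powr (k - 1) * d" using assms powr_add[of d "k - 1" 1] by simp
  moreover have "k * (P * e) + \<sigma> * (P * d * (1 / s)\<^sup>2 * e) = P * e * (k + \<sigma> * d / s\<^sup>2)" for P e s :: real
    by (simp add: power_divide distrib_left mult_ac)
  ultimately show ?thesis using assms by (simp add: flat_def)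
qed

text \<open>The cutoff adds \<open>\<sigma> d / (d-\<sigma>)^2\<close> to the factor
  \<open>k\<close>. For \<open>d \<ge> (T+1) \<sigma>\<close> one has
  \<open>d - \<sigma> \<ge> T \<sigma>\<close> and \<open>d \<le> 2 (d-\<sigma>)\<close>, so the
  addition is at most \<open>2/T\<close>.\<close>

lemma flat_derivative_far:
  fixes \<sigma> k T d :: real
  assumes "0 < \<sigma>" "0 < k" "1 \<le> T" "(T + 1) * \<sigma> \<le> d"
  shows "k * flat \<sigma> (k - 1) 0 d + \<sigma> * flat \<sigma> k 2 d \<le> (k + 2 / T) * (flat \<sigma> k 0 d / d)"
proof -
  define s where "s = d - \<sigma>"
  have Ts: "T * \<sigma> \<le> s" using assms by (simp add: s_def algebra_simps)
  have "1 * \<sigma> \<le> T * \<sigma>" using assms by (intro mult_right_mono) auto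
  then have s: "\<sigma> \<le> s" "0 < s" "d = s + \<sigma>" using Ts assms(1) unfolding s_def by linarith+
  have d: "\<sigma> < d" "0 < d" using s assms(1) by linarith+
  have "\<sigma> * d / s\<^sup>2 \<le> 2 / T"
  proof -
    have "\<sigma> * d * T \<le> (\<sigma> * T) * (2 * s)" using s assms by (simp add: mult_ac)
    also have "\<dots> \<le> s * (2 * s)" using Ts s by (intro mult_right_mono) (auto simp: mult_ac)
    finally show ?thesis using s assms by (simp add: field_simps power2_eq_square)
  qed
  moreover have "k * flat \<sigma> (k - 1) 0 d + \<sigma> * flat \<sigma> k 2 d = (flat \<sigma> k 0 d / d) * (k + \<sigma> * d / s\<^sup>2)"
  proof -
    have "d powr (k - 1) = d powr k / d" using d by (simp add: powr_diff)
    then have "d powr (k - 1) * exp (- (\<sigma> / (d - \<sigma>))) = flat \<sigma> k 0 d / d"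
      using d by (simp add: flat_def)
    then show ?thesis using flat_derivative_eq[OF assms(1) d(1), of k] by (simp only: s_def)
  qed
  moreover have "0 \<le> flat \<sigma> k 0 d / d" using d by (simp add: flat_def)
  ultimately show ?thesis
    using mult_left_mono[of "k + \<sigma> * d / s\<^sup>2" "k + 2 / T" "flat \<sigma> k 0 d / d"]
    by (simp only: mult.commute)
qed

text \<open>In the scaled variable \<open>y = \<sigma>/(d-\<sigma>)\<close> the cutoff contributes
  \<open>(y + y^2) exp (- y) \<le> 1! + 2!\<close>, uniformly in \<open>\<sigma>\<close>. Together
  with \<open>k exp (- y) \<le> 1\<close> this gives the constant 4.\<close>

lemma flat_derivative_near:
  fixes \<sigma> k d :: real
  assumes "0 < \<sigma>" "0 < k" "k < 1"
  shows "k * flat \<sigma> (k - 1) 0 d + \<sigma> * flat \<sigma> k 2 d \<le> 4 * \<sigma> powr (k - 1)"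
proof (cases "\<sigma> < d")
  case True
  define y where "y = \<sigma> / (d - \<sigma>)"
  have y: "0 < y" using True assms by (simp add: y_def)
  have "\<sigma> * d / (d - \<sigma>)\<^sup>2 = y + y\<^sup>2"
  proof -
    have "d = (d - \<sigma>) * (1 + y)" using True by (simp add: y_def distrib_left)
    then have "\<sigma> * d / (d - \<sigma>)\<^sup>2 = \<sigma> * ((d - \<sigma>) * (1 + y)) / (d - \<sigma>)\<^sup>2" by simp
    also have "\<dots> = y * (1 + y)" using True by (simp add: y_def power2_eq_square)
    finally show ?thesis by (simp add: power2_eq_square algebra_simps)
  qed
  then have "k * flat \<sigma> (k - 1) 0 d + \<sigma> * flat \<sigma> k 2 d
      = d powr (k - 1) * exp (- y) * (k + (y + y\<^sup>2))"
    using flat_derivative_eq[OF assms(1) True, of k] by (simp add: y_def)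
  also have "\<dots> = d powr (k - 1) * (k * exp (- y) + (y + y\<^sup>2) * exp (- y))"
    by (simp add: algebra_simps)
  also have "\<dots> \<le> \<sigma> powr (k - 1) * (1 * 1 + (1 + 2))"
  proof (intro mult_mono add_mono)
    show "d powr (k - 1) \<le> \<sigma> powr (k - 1)" using True assms by (intro powr_mono2') auto
    show "(y + y\<^sup>2) * exp (- y) \<le> 1 + 2"
      using power_mult_exp_minus_le[of y 1] power_mult_exp_minus_le[of y 2] y
      by (simp add: distrib_right)
  qed (use y assms in auto)
  finally show ?thesis by simp
qed (simp add: flat_def)

text \<open>\<open>ln t \<le> t - 1\<close> at \<open>t = (R/r)^2\<close>.\<close>

lemma ln_ratio_le:
  fixes r R :: real
  assumes "0 < r" "0 < R"
  shows "2 * r\<^sup>2 * ln (R / r) \<le> R\<^sup>2 - r\<^sup>2"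
proof -
  have "2 * ln (R / r) = ln ((R / r)\<^sup>2)" using assms by (simp add: ln_realpow)
  also have "\<dots> \<le> (R / r)\<^sup>2 - 1" using assms by (intro ln_le_minus_one) simp
  finally have "r\<^sup>2 * (2 * ln (R / r)) \<le> r\<^sup>2 * ((R / r)\<^sup>2 - 1)" by (intro mult_left_mono) auto
  then show ?thesis using assms by (simp add: power_divide algebra_simps)
qed

section \<open>Optimality\<close>

text \<open>The ball is split at \<open>d = (T+1) \<sigma>\<close>. In the boundary layer the
  density is at most \<open>(8R)^p / \<sigma>\<close> and the volume is of order
  \<open>(T+1) \<sigma>\<close>, so the additive constant is independent of \<open>\<sigma>\<close>;
  this uniformity is what optimality needs.\<close>

lemma flat_radial_energy_le:
  fixes p R \<sigma> \<kappa> T :: real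
  defines "k \<equiv> (p - 1) / p"
  defines "\<phi> \<equiv> \<lambda>x::'a::euclidean_space. flat \<sigma> k 0 (R\<^sup>2 - x \<bullet> x)"
  defines "d\<phi> \<equiv> \<lambda>x::'a. (- 2 * (k * flat \<sigma> (k - 1) 0 (R\<^sup>2 - x \<bullet> x) + \<sigma> * flat \<sigma> k 2 (R\<^sup>2 - x \<bullet> x))) *\<^sub>R x"
  assumes p: "1 < p" and R: "0 < R" and \<sigma>: "0 < \<sigma>" and T: "1 \<le> T" "k + 2 / T \<le> \<kappa>"
  shows "radial_energy p R d\<phi> \<le> ennreal (\<kappa> powr p) * hardy_integral p p R \<phi>
    + ennreal ((8 * R) powr p * (DIM('a) * R ^ DIM('a) / R\<^sup>2 * measure lborel (ball (0::'a) 1) * (T + 1)))"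
proof -
  let ?M = "lebesgue_on (ball (0::'a) R)"
  define L where "L x = ln (R / norm x)" for x :: 'a
  define d where "d x = R\<^sup>2 - x \<bullet> x" for x :: 'a
  define w where "w x = k * flat \<sigma> (k - 1) 0 (d x) + \<sigma> * flat \<sigma> k 2 (d x)" for x
  define h where "h x = \<bar>\<phi> x\<bar> powr p / (norm x powr p * L x powr p)" for x
  define S where "S = {x \<in> ball (0::'a) R. d x < (T + 1) * \<sigma>}"
  \<comment> \<open>The \<open>p\<close>-th power of \<open>2 R * 4 \<sigma>^(k-1)\<close>, since
    \<open>(k - 1) p = - 1\<close>.\<close>
  define K where "K = (8 * R) powr p / \<sigma>"
  have k: "0 < k" "k < 1" "(k - 1) * p = - 1" using p by (auto simp: k_def field_simps)
  have f0: "0 \<le> flat \<sigma> a m t" for a m t using \<sigma> by (simp add: flat_def)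
  have w0: "0 \<le> w x" for x using k \<sigma> f0 by (simp add: w_def)
  have \<kappa>: "0 < \<kappa>" using k T by (smt (verit) divide_nonneg_nonneg)
  have S: "S \<in> sets borel" unfolding S_def d_def by measurable
  have e: "\<bar>d\<phi> x \<bullet> (x /\<^sub>R norm x)\<bar> = 2 * norm x * w x" for x
  proof (cases "x = 0")
    case False
    then show ?thesis
      using w0[of x] unfolding d\<phi>_def w_def[symmetric] d_def[symmetric]
      by (simp add: abs_mult dot_square_norm power2_eq_square)
  qed (simp add: d\<phi>_def)
  have pointwise: "(2 * norm x * w x) powr p \<le> \<kappa> powr p * h x + K * indicator S x"
    if x: "x \<in> ball 0 R" for x
  proof (cases "d x < (T + 1) * \<sigma>")
    case True
    then have xS: "x \<in> S" using x by (simp add: S_def)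
    have "2 * norm x * w x \<le> 2 * R * (4 * \<sigma> powr (k - 1))"
      using x w0[of x] R flat_derivative_near[OF \<sigma> k(1,2), of "d x"] unfolding w_def
      by (intro mult_mono) auto
    then have "(2 * norm x * w x) powr p \<le> (8 * R * \<sigma> powr (k - 1)) powr p"
      using w0[of x] p by (intro powr_mono2) auto
    also have "\<dots> = K"
      using R \<sigma> k(3) by (simp add: K_def powr_mult powr_powr powr_minus_divide)
    finally have "(2 * norm x * w x) powr p \<le> K" .
    moreover have "0 \<le> \<kappa> powr p * h x" by (simp add: h_def)
    ultimately show ?thesis using xS by simp
  next
    case False
    show ?thesis
    proof (cases "x = 0")
      case nz: False
      have Lx: "0 < L x" using x nz R by (simp add: L_def)
      have dx: "0 < d x" using False T \<sigma> by (smt (verit) mult_pos_pos)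
      have ln: "2 * (norm x)\<^sup>2 * L x \<le> d x"
        using ln_ratio_le[of "norm x" R] nz R by (simp add: L_def d_def dot_square_norm)
      have "w x \<le> (k + 2 / T) * (\<phi> x / d x)"
        using flat_derivative_far[OF \<sigma> k(1) T(1), of "d x"] False
        unfolding w_def \<phi>_def d_def[symmetric] by simp
      also have "\<dots> \<le> \<kappa> * (\<phi> x / d x)"
        using T(2) dx f0 by (intro mult_right_mono) (auto simp: \<phi>_def)
      finally have "2 * norm x * w x \<le> 2 * norm x * (\<kappa> * (\<phi> x / d x))"
        by (intro mult_left_mono) auto
      also have "\<dots> = \<kappa> * \<phi> x * (2 * norm x / d x)" by simp
      \<comment> \<open>The comparison \<open>2 |x|^2 L \<le> d\<close> replaces the algebraic
        distance by the logarithm in the Hardy density.\<close>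
      also have "\<dots> \<le> \<kappa> * \<phi> x * (1 / (norm x * L x))"
      proof (rule mult_left_mono)
        show "2 * norm x / d x \<le> 1 / (norm x * L x)"
          using ln dx Lx nz by (simp add: divide_simps power2_eq_square mult_ac)
        show "0 \<le> \<kappa> * \<phi> x" using \<kappa> f0 by (simp add: \<phi>_def)
      qed
      finally have "(2 * norm x * w x) powr p \<le> (\<kappa> * \<phi> x * (1 / (norm x * L x))) powr p"
        using w0[of x] p by (intro powr_mono2) auto
      also have "\<dots> = \<kappa> powr p * h x"
        using \<kappa> f0 nz Lx by (simp add: h_def \<phi>_def powr_mult powr_divide)
      finally show ?thesis using \<sigma> by (simp add: K_def add_increasing2)
    qed (use \<sigma> in \<open>simp add: h_def K_def\<close>)
  qed
  have hm: "(\<lambda>x. ennreal (h x)) \<in> borel_measurable ?M"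
  proof -
    have "\<phi> \<in> borel_measurable ?M"
      unfolding \<phi>_def by (rule test_function_measurable[OF GDERIV_flat_radial[OF \<sigma>]])
    from hardy_integral_measurable[OF this, of "\<lambda>t. 1 / (t powr p * ln (R / t) powr p)" p]
    show ?thesis by (simp add: h_def L_def)
  qed
  have "radial_energy p R d\<phi> \<le> (\<integral>\<^sup>+x. ennreal (\<kappa> powr p) * ennreal (h x) + ennreal K * indicator S x \<partial>?M)"
    unfolding radial_energy_def e
  proof (rule nn_integral_mono)
    fix x assume "x \<in> space ?M"
    then have "(2 * norm x * w x) powr p \<le> \<kappa> powr p * h x + K * indicator S x" by (intro pointwise) simp
    then have "ennreal ((2 * norm x * w x) powr p) \<le> ennreal (\<kappa> powr p * h x + K * indicator S x)"
      by (rule ennreal_leI)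
    also have "\<dots> = ennreal (\<kappa> powr p * h x) + ennreal (K * indicator S x)"
      using \<sigma> by (intro ennreal_plus) (auto simp: h_def K_def)
    also have "\<dots> = ennreal (\<kappa> powr p) * ennreal (h x) + ennreal K * indicator S x"
      by (simp add: ennreal_mult' indicator_def)
    finally show "ennreal ((2 * norm x * w x) powr p) \<le> ennreal (\<kappa> powr p) * ennreal (h x) + ennreal K * indicator S x" .
  qed
  also have "\<dots> = ennreal (\<kappa> powr p) * (\<integral>\<^sup>+x. ennreal (h x) \<partial>?M) + (\<integral>\<^sup>+x. ennreal K * indicator S x \<partial>?M)"
  proof -
    have "(\<lambda>x. ennreal K * indicator S x) \<in> borel_measurable ?M"
      using S by (intro borel_measurable_imp_lebesgue_on) simp
    then show ?thesis using hm by (simp add: nn_integral_add nn_integral_cmult)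
  qed
  also have "(\<integral>\<^sup>+x. ennreal K * indicator S x \<partial>?M) = ennreal K * emeasure lborel S"
    using S by (subst nn_integral_lebesgue_on_eq_lborel) (auto simp: S_def nn_integral_cmult_indicator)
  also have "(\<integral>\<^sup>+x. ennreal (h x) \<partial>?M) = hardy_integral p p R \<phi>"
    by (simp add: hardy_integral_def h_def L_def)
  also have "ennreal K * emeasure lborel S \<le> ennreal K * ennreal (DIM('a) * R ^ DIM('a) / R\<^sup>2 * measure lborel (ball (0::'a) 1) * ((T + 1) * \<sigma>))"
    unfolding S_def d_def using \<sigma> T by (intro mult_left_mono emeasure_boundary_layer_le R) auto
  also have "\<dots> = ennreal ((8 * R) powr p * (DIM('a) * R ^ DIM('a) / R\<^sup>2 * measure lborel (ball (0::'a) 1) * (T + 1)))"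
    using \<sigma> T R by (subst ennreal_mult[symmetric]) (auto simp: K_def)
  finally show ?thesis by (simp add: add_left_mono)
qed

text \<open>On the first \<open>n\<close> dyadic shells the cutoff costs at most a factor
  \<open>e\<close>, and the Hardy density is at least \<open>(R/e)^p / d\<close>. The exponent
  \<open>Suc n\<close> puts \<open>\<sigma>\<close> at half the innermost level, so that
  \<open>d > 2 \<sigma>\<close> on all these shells.\<close>

lemma flat_radial_hardy_ge:
  fixes p R :: real and n :: nat
  defines "k \<equiv> (p - 1) / p"
  defines "\<sigma> \<equiv> 3 * R\<^sup>2 / 4 / 2 ^ Suc n"
  assumes N: "2 \<le> DIM('a::euclidean_space)" and p: "1 < p" and R: "0 < R"
  shows "ennreal ((R / exp 1) powr p * (n * ((R / 2) ^ (DIM('a) - 2) * measure lborel (ball (0::'a) 1) / 2)))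
    \<le> hardy_integral p p R (\<lambda>x::'a. flat \<sigma> k 0 (R\<^sup>2 - x \<bullet> x))"
proof -
  let ?M = "lebesgue_on (ball (0::'a) R)"
  define D where "D = 3 * R\<^sup>2 / 4"
  define L where "L x = ln (R / norm x)" for x :: 'a
  define d where "d x = R\<^sup>2 - x \<bullet> x" for x :: 'a
  define S where "S = {x. D / 2 ^ n < d x \<and> d x \<le> D}"
  have D: "0 < D" using R by (simp add: D_def)
  have \<sigma>: "0 < \<sigma>" "2 * \<sigma> = D / 2 ^ n" using D by (auto simp: \<sigma>_def D_def)
  have k: "0 < k" "(k - 1) * p = - 1" using p by (auto simp: k_def field_simps)
  have key: "(R / exp 1) powr p * (1 / d x) \<le> \<bar>flat \<sigma> k 0 (d x)\<bar> powr p / (norm x powr p * L x powr p)"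
    if x: "x \<in> S" "x \<in> ball 0 R" for x
  proof -
    have dx: "2 * \<sigma> < d x" "d x \<le> D" using x(1) \<sigma> by (auto simp: S_def)
    have "(R / 2)\<^sup>2 \<le> (norm x)\<^sup>2" using dx(2) by (simp add: d_def D_def dot_square_norm power_divide)
    then have nx: "R / 2 \<le> norm x" by (rule power2_le_imp_le) simp
    then have x0: "0 < norm x" using R by linarith
    have Lx: "0 < L x" using x x0 R by (simp add: L_def)
    have "2 * (norm x)\<^sup>2 * L x \<le> d x"
      using ln_ratio_le[of "norm x" R] x0 R by (simp add: L_def d_def dot_square_norm)
    then have 1: "2 * norm x / d x \<le> 1 / (norm x * L x)"
      using dx \<sigma> Lx x0 by (simp add: divide_simps power2_eq_square mult_ac)
    \<comment> \<open>Hence the exponential factor of \<open>flat\<close> is at least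
      \<open>1/e\<close>.\<close>
    have "\<sigma> / (d x - \<sigma>) \<le> 1" using dx(1) \<sigma>(1) by simp
    then have 2: "d x powr k * (1 / exp 1) \<le> flat \<sigma> k 0 (d x)"
      using dx(1) \<sigma>(1) by (simp add: flat_def exp_minus[symmetric] divide_inverse)
    have "R / exp 1 * d x powr (k - 1) = (d x powr k * (1 / exp 1)) * (R / d x)"
      using dx(1) \<sigma>(1) by (simp add: powr_diff)
    also have "\<dots> \<le> flat \<sigma> k 0 (d x) * (2 * norm x / d x)"
      using 2 nx dx(1) \<sigma>(1) R by (intro mult_mono divide_right_mono) (auto simp: flat_def)
    also have "\<dots> \<le> flat \<sigma> k 0 (d x) * (1 / (norm x * L x))"
      using 1 by (intro mult_left_mono) (auto simp: flat_def)
    finally have "(R / exp 1 * d x powr (k - 1)) powr p \<le> (flat \<sigma> k 0 (d x) * (1 / (norm x * L x))) powr p"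
      using p R by (intro powr_mono2) auto
    moreover have "(R / exp 1 * d x powr (k - 1)) powr p = (R / exp 1) powr p * (1 / d x)"
    proof -
      have "(R / exp 1 * d x powr (k - 1)) powr p = (R / exp 1) powr p * (d x powr (k - 1)) powr p"
        by (rule powr_mult)
      then show ?thesis using dx(1) \<sigma>(1) k(2) by (simp add: powr_powr powr_minus_divide)
    qed
    moreover have "(flat \<sigma> k 0 (d x) * (1 / (norm x * L x))) powr p = \<bar>flat \<sigma> k 0 (d x)\<bar> powr p / (norm x powr p * L x powr p)"
      using x0 Lx by (simp add: powr_mult powr_divide flat_def)
    ultimately show ?thesis by simp
  qed
  have Sball: "S \<subseteq> ball 0 R"
  proof
    fix x assume "x \<in> S"
    moreover have "0 < D / 2 ^ n" using D by simp
    ultimately have "(norm x)\<^sup>2 < R\<^sup>2" unfolding S_def d_def by (simp add: dot_square_norm)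
    then show "x \<in> ball 0 R" using R power_less_imp_less_base[of "norm x" 2 R] by simp
  qed
  have "ennreal ((R / exp 1) powr p * (n * ((R / 2) ^ (DIM('a) - 2) * measure lborel (ball (0::'a) 1) / 2)))
      = ennreal ((R / exp 1) powr p) * ennreal (n * ((R / 2) ^ (DIM('a) - 2) * measure lborel (ball (0::'a) 1) / 2))"
    by (rule ennreal_mult') simp
  also have "\<dots> \<le> ennreal ((R / exp 1) powr p) * (\<integral>\<^sup>+x. ennreal (1 / d x) * indicator S x \<partial>lborel)"
    unfolding S_def d_def D_def by (intro mult_left_mono nn_integral_inverse_dist_ge N R) auto
  also have "\<dots> = ennreal ((R / exp 1) powr p) * (\<integral>\<^sup>+x. ennreal (1 / d x) * indicator S x \<partial>?M)"
    using Sball by (subst nn_integral_lebesgue_on_eq_lborel) (auto simp: indicator_def)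
  also have "\<dots> = (\<integral>\<^sup>+x. ennreal ((R / exp 1) powr p) * (ennreal (1 / d x) * indicator S x) \<partial>?M)"
    unfolding S_def d_def
    by (intro nn_integral_cmult[symmetric] borel_measurable_imp_lebesgue_on) measurable
  also have "\<dots> \<le> hardy_integral p p R (\<lambda>x. flat \<sigma> k 0 (d x))"
    unfolding hardy_integral_def L_def[symmetric]
  proof (rule nn_integral_mono)
    fix x assume "x \<in> space ?M"
    then have "x \<in> ball 0 R" by simp
    then show "ennreal ((R / exp 1) powr p) * (ennreal (1 / d x) * indicator S x)
        \<le> ennreal (\<bar>flat \<sigma> k 0 (d x)\<bar> powr p / (norm x powr p * L x powr p))"
      using ennreal_leI[OF key] by (cases "x \<in> S") (simp_all add: ennreal_mult'[symmetric])
  qed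
  finally show ?thesis by (simp add: d_def)
qed

text \<open>A constant \<open>C > k^p\<close> leaves room for \<open>\<kappa>\<close> with
  \<open>k^p < \<kappa>^p < C\<close>. Then \<open>(C - \<kappa>^p) H \<le> K\<close> with
  \<open>K\<close> independent of \<open>n\<close>, whereas \<open>H \<ge> n c\<close> for the test
  functions.\<close>

lemma hardy_optimal:
  fixes p R C :: real
  assumes N: "2 \<le> DIM('a::euclidean_space)" and p: "1 < p" "p \<le> DIM('a)" and R: "0 < R"
    and C: "\<And>(u :: 'a \<Rightarrow> real) g. W0 p (ball 0 R) u g \<Longrightarrow>
      ennreal C * hardy_integral p p R u \<le> radial_energy p R g"
  shows "C \<le> ((p - 1) / p) powr p"
proof (rule ccontr)
  define k where "k = (p - 1) / p"
  assume "\<not> C \<le> ((p - 1) / p) powr p"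
  then have Ck: "k powr p < C" by (simp add: k_def)
  have k: "0 < k" using p by (simp add: k_def)
  then have C0: "0 < C" using Ck by (smt (verit) powr_ge_zero)
  \<comment> \<open>The midpoint between \<open>k\<close> and \<open>C^(1/p)\<close>.\<close>
  define \<kappa> where "\<kappa> = (k + C powr (1 / p)) / 2"
  have "(k powr p) powr (1 / p) < C powr (1 / p)"
    using Ck p by (intro powr_less_mono2) auto
  then have \<kappa>: "k < \<kappa>" "\<kappa> < C powr (1 / p)" using k p by (auto simp: \<kappa>_def powr_powr)
  then have "\<kappa> powr p < (C powr (1 / p)) powr p"
    using k p by (intro powr_less_mono2) auto
  then have \<kappa>C: "\<kappa> powr p < C" using p C0 by (simp add: powr_powr)
  \<comment> \<open>Large enough that the cutoff error \<open>2/T\<close> fits into the gap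
    \<open>\<kappa> - k\<close>.\<close>
  define T where "T = max 1 (2 / (\<kappa> - k))"
  have T: "1 \<le> T" "k + 2 / T \<le> \<kappa>"
  proof -
    have "2 / T \<le> 2 / (2 / (\<kappa> - k))" using \<kappa> by (intro divide_left_mono) (auto simp: T_def)
    then show "k + 2 / T \<le> \<kappa>" by simp
  qed (simp add: T_def)
  define K where "K = (8 * R) powr p * (DIM('a) * R ^ DIM('a) / R\<^sup>2 * measure lborel (ball (0::'a) 1) * (T + 1))"
  define c where "c = (R / exp 1) powr p * ((R / 2) ^ (DIM('a) - 2) * measure lborel (ball (0::'a) 1) / 2)"
  have K: "0 \<le> K" using R T by (simp add: K_def)
  have "0 < measure lborel (ball (0::'a) 1)" by (rule content_ball_pos) simp
  then have c: "0 < c" using R by (simp add: c_def)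
  have bound: "(C - \<kappa> powr p) * (n * c) \<le> K" for n :: nat
  proof -
    define \<sigma> where "\<sigma> = 3 * R\<^sup>2 / 4 / 2 ^ Suc n"
    define \<phi> where "\<phi> x = flat \<sigma> k 0 (R\<^sup>2 - x \<bullet> x)" for x :: 'a
    define d\<phi> where "d\<phi> x = (- 2 * (k * flat \<sigma> (k - 1) 0 (R\<^sup>2 - x \<bullet> x) + \<sigma> * flat \<sigma> k 2 (R\<^sup>2 - x \<bullet> x))) *\<^sub>R x" for x :: 'a
    have \<sigma>: "0 < \<sigma>" using R by (simp add: \<sigma>_def)
    have "\<sigma> \<le> 3 * R\<^sup>2 / 4 / 1"
      unfolding \<sigma>_def by (intro divide_left_mono one_le_power) auto
    moreover have "0 < R\<^sup>2" using R by simp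
    ultimately have \<sigma>R: "\<sigma> < R\<^sup>2" by linarith
    have W: "W0 p (ball 0 R) \<phi> d\<phi>"
      unfolding \<phi>_def d\<phi>_def using p
      by (intro W0_test_function flat_radial_Cc_infinity[OF \<sigma> \<sigma>R R] GDERIV_flat_radial[OF \<sigma>]) auto
    define H where "H = hardy_integral p p R \<phi>"
    have "ennreal (k powr p) * H \<le> radial_energy p R d\<phi>"
      unfolding H_def k_def
      by (rule order_trans[OF add_increasing2[OF zero_le order_refl] hardy_improved[OF p R W]])
    \<comment> \<open>The Hardy inequality itself shows that \<open>H\<close> is finite, so that
      \<open>\<kappa>^p H\<close> can be subtracted.\<close>
    then have "ennreal (k powr p) * H < \<infinity>"
      using radial_energy_W0_finite[OF W p(1)] by (rule le_less_trans)
    then have "H < \<infinity>" using k by (auto simp: ennreal_mult_less_top)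
    then obtain H' where H': "H = ennreal H'" "0 \<le> H'" by (cases H) auto
    have "ennreal C * H \<le> ennreal (\<kappa> powr p) * H + ennreal K"
      using C[OF W] flat_radial_energy_le[where 'a = 'a, OF p(1) R \<sigma> T(1), of \<kappa>] T(2)
      unfolding H_def \<phi>_def d\<phi>_def K_def k_def by (meson order_trans)
    then have "ennreal (C * H') \<le> ennreal (\<kappa> powr p * H' + K)"
      using H' C0 K by (simp add: ennreal_mult[symmetric] ennreal_plus[symmetric] del: ennreal_plus)
    then have "(C - \<kappa> powr p) * H' \<le> K"
      using H' K by (subst (asm) ennreal_le_iff) (auto simp: algebra_simps)
    moreover have "ennreal (n * c) \<le> ennreal H'"
      using flat_radial_hardy_ge[OF N p(1) R, of n]
      unfolding H'(1)[symmetric] H_def \<phi>_def k_def c_def \<sigma>_def by (simp add: mult_ac)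
    then have "n * c \<le> H'" using H' by (simp add: ennreal_le_iff)
    then have "(C - \<kappa> powr p) * (n * c) \<le> (C - \<kappa> powr p) * H'"
      using \<kappa>C by (intro mult_left_mono) auto
    ultimately show ?thesis by linarith
  qed
  obtain n :: nat where "K / ((C - \<kappa> powr p) * c) < n" using reals_Archimedean2 by blast
  then have "K < n * ((C - \<kappa> powr p) * c)" using c \<kappa>C by (simp add: pos_divide_less_eq)
  then show False using bound[of n] by (simp add: mult_ac)
qed

theorem theorem2:
  fixes p R :: real
  assumes "2 \<le> DIM('a::euclidean_space)"
    and "1 < p" and "p \<le> real DIM('a)"
    and "0 < R"
  shows
    "(\<forall>(u :: 'a \<Rightarrow> real) g. W0 p (ball 0 R) u g \<longrightarrow>
        ennreal (((p - 1) / p) powr p) * hardy_integral p p R u \<le> radial_energy p R g) \<and>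
     (\<forall>C :: real.
        (\<forall>(u :: 'a \<Rightarrow> real) g. W0 p (ball 0 R) u g \<longrightarrow>
           ennreal C * hardy_integral p p R u \<le> radial_energy p R g)
        \<longrightarrow> C \<le> ((p - 1) / p) powr p) \<and>
     (\<forall>(u :: 'a \<Rightarrow> real) g. W0 p (ball 0 R) u g \<longrightarrow>
        \<not> (AE x in lebesgue_on (ball 0 R). u x = 0) \<longrightarrow>
        ennreal (((p - 1) / p) powr p) * hardy_integral p p R u \<noteq> radial_energy p R g) \<and>
     (\<forall>(u :: 'a \<Rightarrow> real) g. W0 p (ball 0 R) u g \<longrightarrow>
        ennreal (((p - 1) / p) powr p) * hardy_integral p p R u + remainder p R u
          \<le> radial_energy p R g)"
proof (intro conjI allI impI)
  fix u :: "'a \<Rightarrow> real" and g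
  assume W: "W0 p (ball 0 R) u g"
  show improved: "ennreal (((p - 1) / p) powr p) * hardy_integral p p R u + remainder p R u
      \<le> radial_energy p R g"
    by (rule hardy_improved[OF assms(2-4) W])
  show "ennreal (((p - 1) / p) powr p) * hardy_integral p p R u \<le> radial_energy p R g"
    using order_trans[OF add_increasing2[OF zero_le order_refl] improved] .
  assume "\<not> (AE x in lebesgue_on (ball 0 R). u x = 0)"
  then show "ennreal (((p - 1) / p) powr p) * hardy_integral p p R u \<noteq> radial_energy p R g"
    using hardy_not_attained[OF assms(2-4) W] by blast
next
  fix C :: real
  assume "\<forall>(u :: 'a \<Rightarrow> real) g. W0 p (ball 0 R) u g \<longrightarrow>
    ennreal C * hardy_integral p p R u \<le> radial_energy p R g"
  then show "C \<le> ((p - 1) / p) powr p"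
    by (intro hardy_optimal[where 'a = 'a, OF assms]) blast
qed

end
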